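(* The Cauchy dual of an expansive operator of class $\mathcal{Q}$ is a subnormal contraction; that is, if $T\in B(\mathcal{H})$ is an operator of class $\mathcal{Q}$ on a complex Hilbert space $\mathcal{H}$ and $T^*T\geqslant I$, then $T'=T(T^*T)^{-1}$ is subnormal and $\|T'\|\leqslant 1$.
   Context: $B(\mathcal{H},\mathcal{K})$ denotes the bounded linear operators between complex Hilbert spaces, $B(\mathcal{H})=B(\mathcal{H},\mathcal{H})$. An operator $T\in B(\mathcal{H})$ is of class $\mathcal{Q}$ if there is an orthogonal decomposition $\mathcal{H}=\mathcal{H}_1\oplus\mathcal{H}_2$ with $\mathcal{H}_1\neq\{0\}$, $\mathcal{H}_2\neq\{0\}$, relative to which $T=\begin{bmatrix} V & E\\ 0 & Q\end{bmatrix}$ with $V\in B(\mathcal{H}_1)$, $E\in B(\mathcal{H}_2,\mathcal{H}_1)$, $Q\in B(\mathcal{H}_2)$ satisfying $V^*V=I$, $V^*E=0$, $QE^*E=E^*EQ$, and $Q$ is quasinormal, i.e. $QQ^*Q=Q^*QQ$. For a left-invertible $T\in B(\mathcal{H})$ (in particular for an expansive one), the Cauchy dual of $T$ is $T'=T(T^*T)^{-1}$. $T$ is expansive if $T^*T\geqslant I$, and a contraction if $T^*T\leqslant I$. $T\in B(\mathcal{H})$ is subnormal if it is the restriction to $\mathcal{H}$ of a normal operator on some complex Hilbert space $\mathcal{K}\supseteq\mathcal{H}$. *)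

theory Defs
  imports "HOL-Analysis.Analysis"
begin

section \<open>Complex Hilbert spaces\<close>

text \<open>
  A complex inner product space is a real one carrying a compatible complex scalar
  multiplication and a sesquilinear form (linear in the first argument) whose real part is the
  real inner product.  Positive definiteness of \<open>cinner\<close> and
  \<open>norm x ^ 2 = cinner x x\<close> are then inherited from \<^class>\<open>real_inner\<close>.
\<close>

class complex_inner = real_inner +
  fixes scaleC :: "complex \<Rightarrow> 'a \<Rightarrow> 'a"  (infixr "*\<^sub>C" 75)
    and cinner :: "'a \<Rightarrow> 'a \<Rightarrow> complex"
  assumes scaleC_add_right: "c *\<^sub>C (x + y) = c *\<^sub>C x + c *\<^sub>C y"
    and scaleC_add_left: "(c + d) *\<^sub>C x = c *\<^sub>C x + d *\<^sub>C x"
    and scaleC_scaleC: "c *\<^sub>C (d *\<^sub>C x) = (c * d) *\<^sub>C x"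
    and scaleC_of_real: "complex_of_real r *\<^sub>C x = r *\<^sub>R x"
    and cinner_commute: "cinner x y = cnj (cinner y x)"
    and cinner_add_left: "cinner (x + y) z = cinner x z + cinner y z"
    and cinner_scaleC_left: "cinner (c *\<^sub>C x) y = c * cinner x y"
    and Re_cinner: "Re (cinner x y) = inner x y"

class complex_hilbert = complex_inner + complete_space

instantiation complex :: complex_hilbert
begin

definition scaleC_complex :: "complex \<Rightarrow> complex \<Rightarrow> complex"
  where "scaleC_complex c x = c * x"
definition cinner_complex :: "complex \<Rightarrow> complex \<Rightarrow> complex"
  where "cinner_complex x y = x * cnj y"

instance
  by standard
    (auto simp: scaleC_complex_def cinner_complex_def inner_complex_def algebra_simps
      scaleR_conv_of_real)

end

lemma norm_scaleC:
  fixes x :: "'a::complex_inner"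
  shows "norm (c *\<^sub>C x) = cmod c * norm x"
proof -
  have self: "cinner y y = complex_of_real ((norm y)\<^sup>2)" for y :: 'a
    using cinner_commute [of y y] Re_cinner [of y y]
    by (auto simp: complex_eq_iff power2_norm_eq_inner)
  have "cinner (c *\<^sub>C x) (c *\<^sub>C x) = c * cnj c * cinner x x"
    by (metis cinner_commute cinner_scaleC_left complex_cnj_mult mult.assoc)
  then have "complex_of_real ((norm (c *\<^sub>C x))\<^sup>2) = complex_of_real ((cmod c * norm x)\<^sup>2)"
    by (simp add: self complex_mult_cnj cmod_power2 power_mult_distrib)
  then have "(norm (c *\<^sub>C x))\<^sup>2 = (cmod c * norm x)\<^sup>2"
    by (simp only: of_real_eq_iff)
  then show ?thesis by simp
qed

lemma cinner_via_inner:
  fixes x :: "'a::complex_inner"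
  shows "cinner x y = Complex (inner x y) (- inner (\<i> *\<^sub>C x) y)"
  using Re_cinner [of x y] Re_cinner [of "\<i> *\<^sub>C x" y]
  by (simp add: complex_eq_iff cinner_scaleC_left)

section \<open>Square summable sequences in a Hilbert space\<close>

text \<open>
  The countable orthogonal sum of copies of a Hilbert space.  It is the ambient space for the
  normal extensions of an operator, see \<open>subnormal\<close> below.
\<close>

typedef (overloaded) 'a ell2 = "{f :: nat \<Rightarrow> 'a::complex_inner. summable (\<lambda>n. (norm (f n))\<^sup>2)}"
  morphisms ell2_nth Abs_ell2
  by (rule exI [of _ "\<lambda>_. 0"]) simp

setup_lifting type_definition_ell2

lemma summable_ell2_add:
  fixes f g :: "nat \<Rightarrow> 'a::real_normed_vector"
  assumes "summable (\<lambda>n. (norm (f n))\<^sup>2)" and "summable (\<lambda>n. (norm (g n))\<^sup>2)"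
  shows "summable (\<lambda>n. (norm (f n + g n))\<^sup>2)"
proof (rule summable_comparison_test')
  show "summable (\<lambda>n. 2 * (norm (f n))\<^sup>2 + 2 * (norm (g n))\<^sup>2)"
    using assms by (intro summable_add summable_mult)
  fix n :: nat
  have "(norm (f n + g n))\<^sup>2 \<le> (norm (f n) + norm (g n))\<^sup>2"
    by (intro power_mono norm_triangle_ineq norm_ge_zero)
  also have "\<dots> \<le> 2 * (norm (f n))\<^sup>2 + 2 * (norm (g n))\<^sup>2"
    using sum_squares_ge_zero [of "norm (f n) - norm (g n)" 0]
    by (simp add: power2_eq_square algebra_simps)
  finally show "norm ((norm (f n + g n))\<^sup>2) \<le> 2 * (norm (f n))\<^sup>2 + 2 * (norm (g n))\<^sup>2"
    by simp
qed

lemma summable_ell2_inner: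
  fixes f g :: "nat \<Rightarrow> 'a::real_inner"
  assumes "summable (\<lambda>n. (norm (f n))\<^sup>2)" and "summable (\<lambda>n. (norm (g n))\<^sup>2)"
  shows "summable (\<lambda>n. inner (f n) (g n))"
proof (rule summable_comparison_test')
  show "summable (\<lambda>n. (norm (f n))\<^sup>2 + (norm (g n))\<^sup>2)"
    using assms by (intro summable_add)
  fix n :: nat
  have "\<bar>inner (f n) (g n)\<bar> \<le> norm (f n) * norm (g n)"
    by (rule Cauchy_Schwarz_ineq2)
  also have "\<dots> \<le> (norm (f n))\<^sup>2 + (norm (g n))\<^sup>2"
    using sum_squares_bound [of "norm (f n)" "norm (g n)"]
      mult_nonneg_nonneg [OF norm_ge_zero [of "f n"] norm_ge_zero [of "g n"]] by linarith
  finally show "norm (inner (f n) (g n)) \<le> (norm (f n))\<^sup>2 + (norm (g n))\<^sup>2"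
    by simp
qed

lemma summable_ell2_scaleC:
  fixes f :: "nat \<Rightarrow> 'a::complex_inner"
  assumes "summable (\<lambda>n. (norm (f n))\<^sup>2)"
  shows "summable (\<lambda>n. (norm (c *\<^sub>C f n))\<^sup>2)"
  using assms by (simp add: norm_scaleC power_mult_distrib summable_mult)

instantiation ell2 :: (complex_inner) complex_inner
begin

lift_definition zero_ell2 :: "'a ell2" is "\<lambda>_. 0" by simp
lift_definition plus_ell2 :: "'a ell2 \<Rightarrow> 'a ell2 \<Rightarrow> 'a ell2" is "\<lambda>f g n. f n + g n"
  by (rule summable_ell2_add)
lift_definition uminus_ell2 :: "'a ell2 \<Rightarrow> 'a ell2" is "\<lambda>f n. - f n" by simp
lift_definition minus_ell2 :: "'a ell2 \<Rightarrow> 'a ell2 \<Rightarrow> 'a ell2" is "\<lambda>f g n. f n - g n"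
proof -
  fix f g :: "nat \<Rightarrow> 'a"
  assume "summable (\<lambda>n. (norm (f n))\<^sup>2)" "summable (\<lambda>n. (norm (g n))\<^sup>2)"
  then show "summable (\<lambda>n. (norm (f n - g n))\<^sup>2)"
    using summable_ell2_add [of f "\<lambda>n. - g n"] by simp
qed
lift_definition scaleR_ell2 :: "real \<Rightarrow> 'a ell2 \<Rightarrow> 'a ell2" is "\<lambda>r f n. r *\<^sub>R f n"
  by (simp add: power_mult_distrib summable_mult)
lift_definition scaleC_ell2 :: "complex \<Rightarrow> 'a ell2 \<Rightarrow> 'a ell2" is "\<lambda>c f n. c *\<^sub>C f n"
  by (rule summable_ell2_scaleC)

definition inner_ell2 :: "'a ell2 \<Rightarrow> 'a ell2 \<Rightarrow> real"
  where "inner_ell2 f g = (\<Sum>n. inner (ell2_nth f n) (ell2_nth g n))"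
definition cinner_ell2 :: "'a ell2 \<Rightarrow> 'a ell2 \<Rightarrow> complex"
  where "cinner_ell2 f g = (\<Sum>n. cinner (ell2_nth f n) (ell2_nth g n))"
definition norm_ell2 :: "'a ell2 \<Rightarrow> real"
  where "norm_ell2 f = sqrt (inner f f)"
definition dist_ell2 :: "'a ell2 \<Rightarrow> 'a ell2 \<Rightarrow> real"
  where "dist_ell2 f g = norm (f - g)"
definition sgn_ell2 :: "'a ell2 \<Rightarrow> 'a ell2"
  where "sgn_ell2 f = scaleR (inverse (norm f)) f"
definition uniformity_ell2 :: "('a ell2 \<times> 'a ell2) filter"
  where "uniformity_ell2 = (INF e\<in>{0<..}. principal {(f, g). dist f g < e})"
definition open_ell2 :: "'a ell2 set \<Rightarrow> bool"
  where "open_ell2 U \<longleftrightarrow> (\<forall>f\<in>U. \<forall>\<^sub>F (f', g) in uniformity. f' = f \<longrightarrow> g \<in> U)"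

instance
proof
  fix f g h :: "'a ell2" and r s :: real and c d :: complex
  have S: "summable (\<lambda>n. (norm (ell2_nth f n))\<^sup>2)" for f :: "'a ell2"
    using ell2_nth by auto
  have I: "summable (\<lambda>n. inner (ell2_nth f n) (ell2_nth g n))" for f g :: "'a ell2"
    by (intro summable_ell2_inner S)
  have C: "summable (\<lambda>n. cinner (ell2_nth f n) (ell2_nth g n))" for f g :: "'a ell2"
    using I [of f g] I [of "\<i> *\<^sub>C f" g]
    by (simp add: summable_complex_iff cinner_via_inner scaleC_ell2.rep_eq summable_minus_iff)
  show "f + g + h = f + (g + h)" "f + g = g + f" "0 + f = f" "- f + f = 0" "f - g = f + - g"
    by (transfer, simp add: add_ac)+
  show "r *\<^sub>R (f + g) = r *\<^sub>R f + r *\<^sub>R g" "(r + s) *\<^sub>R f = r *\<^sub>R f + s *\<^sub>R f"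
    "r *\<^sub>R s *\<^sub>R f = (r * s) *\<^sub>R f" "1 *\<^sub>R f = f"
    by (transfer, simp add: algebra_simps)+
  show "inner f g = inner g f"
    by (simp add: inner_ell2_def inner_commute)
  show "inner (f + g) h = inner f h + inner g h"
    by (simp add: inner_ell2_def plus_ell2.rep_eq inner_add_left suminf_add [symmetric] I)
  show "inner (r *\<^sub>R f) g = r * inner f g"
    by (simp add: inner_ell2_def scaleR_ell2.rep_eq suminf_mult I)
  show "0 \<le> inner f f"
    by (simp add: inner_ell2_def suminf_nonneg I)
  show "inner f f = 0 \<longleftrightarrow> f = 0"
  proof -
    have "inner f f = 0 \<longleftrightarrow> (\<forall>n. ell2_nth f n = 0)"
      by (simp add: inner_ell2_def suminf_eq_zero_iff I)
    also have "\<dots> \<longleftrightarrow> f = 0"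
      by (auto simp: ell2_nth_inject [symmetric] zero_ell2.rep_eq)
    finally show ?thesis .
  qed
  show "norm f = sqrt (inner f f)" by (rule norm_ell2_def)
  show "dist f g = norm (f - g)" by (rule dist_ell2_def)
  show "sgn f = scaleR (inverse (norm f)) f" by (rule sgn_ell2_def)
  show "(uniformity :: ('a ell2 \<times> 'a ell2) filter)
      = (INF e\<in>{0<..}. principal {(f, g). dist f g < e})"
    by (rule uniformity_ell2_def)
  show "open U \<longleftrightarrow> (\<forall>f\<in>U. \<forall>\<^sub>F (f', g) in uniformity. f' = f \<longrightarrow> g \<in> U)" for U :: "'a ell2 set"
    by (rule open_ell2_def)
  show "c *\<^sub>C (f + g) = c *\<^sub>C f + c *\<^sub>C g" "(c + d) *\<^sub>C f = c *\<^sub>C f + d *\<^sub>C f"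
    "c *\<^sub>C d *\<^sub>C f = (c * d) *\<^sub>C f" "complex_of_real r *\<^sub>C f = r *\<^sub>R f"
    by (transfer, simp add: scaleC_add_right scaleC_add_left scaleC_scaleC scaleC_of_real)+
  have "cnj (cinner g f) = (\<Sum>n. cnj (cinner (ell2_nth g n) (ell2_nth f n)))"
    unfolding cinner_ell2_def
    by (intro bounded_linear.suminf [OF bounded_linear_cnj] C)
  then show "cinner f g = cnj (cinner g f)"
    by (simp add: cinner_ell2_def cinner_commute [symmetric])
  show "cinner (f + g) h = cinner f h + cinner g h"
    by (simp add: cinner_ell2_def plus_ell2.rep_eq cinner_add_left suminf_add [symmetric] C)
  show "cinner (c *\<^sub>C f) g = c * cinner f g"
    by (simp add: cinner_ell2_def scaleC_ell2.rep_eq cinner_scaleC_left suminf_mult C)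
  have "Re (cinner f g) = (\<Sum>n. Re (cinner (ell2_nth f n) (ell2_nth g n)))"
    unfolding cinner_ell2_def
    by (intro bounded_linear.suminf [OF bounded_linear_Re] C)
  then show "Re (cinner f g) = inner f g"
    by (simp add: inner_ell2_def Re_cinner)
qed

end

lemma summable_ell2_nth: "summable (\<lambda>n. (norm (ell2_nth f n))\<^sup>2)"
  using ell2_nth by auto

lemma norm_ell2_squared: "(norm f)\<^sup>2 = (\<Sum>n. (norm (ell2_nth f n))\<^sup>2)"
  by (simp add: power2_norm_eq_inner inner_ell2_def)

instance ell2 :: (complex_hilbert) complex_hilbert
proof
  fix X :: "nat \<Rightarrow> 'a ell2"
  assume X: "Cauchy X"
  have part: "(\<Sum>n<N. (norm (ell2_nth f n))\<^sup>2) \<le> (norm f)\<^sup>2" for N and f :: "'a ell2"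
    unfolding norm_ell2_squared by (rule sum_le_suminf [OF summable_ell2_nth]) auto
  have nth_le: "norm (ell2_nth f n) \<le> norm f" for n and f :: "'a ell2"
  proof -
    have "(norm (ell2_nth f n))\<^sup>2 \<le> (\<Sum>n<Suc n. (norm (ell2_nth f n))\<^sup>2)"
      by (rule member_le_sum) auto
    also have "\<dots> \<le> (norm f)\<^sup>2" by (rule part)
    finally show ?thesis by (rule power2_le_imp_le) simp
  qed
  have "Cauchy (\<lambda>k. ell2_nth (X k) n)" for n
  proof (rule metric_CauchyI)
    fix e :: real
    assume "0 < e"
    then obtain M where M: "\<And>j k. j \<ge> M \<Longrightarrow> k \<ge> M \<Longrightarrow> dist (X j) (X k) < e"
      using metric_CauchyD [OF X] by blast
    have "dist (ell2_nth (X j) n) (ell2_nth (X k) n) \<le> dist (X j) (X k)" for j k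
      using nth_le [of "X j - X k" n] by (simp add: dist_norm minus_ell2.rep_eq)
    then show "\<exists>M. \<forall>j\<ge>M. \<forall>k\<ge>M. dist (ell2_nth (X j) n) (ell2_nth (X k) n) < e"
      using M le_less_trans by blast
  qed
  then have "\<forall>n. \<exists>l. (\<lambda>k. ell2_nth (X k) n) \<longlonglongrightarrow> l"
    by (simp add: Cauchy_convergent_iff convergent_def)
  then obtain L where L: "\<And>n. (\<lambda>k. ell2_nth (X k) n) \<longlonglongrightarrow> L n"
    by metis
  have key: "(\<Sum>n<N. (norm (ell2_nth (X j) n - L n))\<^sup>2) \<le> e\<^sup>2"
    if "\<And>k. k \<ge> M \<Longrightarrow> dist (X j) (X k) < e" for e M j N
  proof (rule Lim_bounded)
    show "(\<lambda>k. \<Sum>n<N. (norm (ell2_nth (X j) n - ell2_nth (X k) n))\<^sup>2)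
        \<longlonglongrightarrow> (\<Sum>n<N. (norm (ell2_nth (X j) n - L n))\<^sup>2)"
      by (intro tendsto_intros L)
    show "\<forall>k\<ge>M. (\<Sum>n<N. (norm (ell2_nth (X j) n - ell2_nth (X k) n))\<^sup>2) \<le> e\<^sup>2"
    proof (intro allI impI)
      fix k
      assume "M \<le> k"
      have "(\<Sum>n<N. (norm (ell2_nth (X j) n - ell2_nth (X k) n))\<^sup>2) \<le> (norm (X j - X k))\<^sup>2"
        using part [of "X j - X k" N] by (simp add: minus_ell2.rep_eq)
      also have "\<dots> \<le> e\<^sup>2"
        using that [OF \<open>M \<le> k\<close>] by (intro power_mono) (auto simp: dist_norm)
      finally show "(\<Sum>n<N. (norm (ell2_nth (X j) n - ell2_nth (X k) n))\<^sup>2) \<le> e\<^sup>2" .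
    qed
  qed
  have sum: "summable (\<lambda>n. (norm (ell2_nth (X j) n - L n))\<^sup>2)"
    if "\<And>k. k \<ge> M \<Longrightarrow> dist (X j) (X k) < e" for e M j
  proof (rule bounded_imp_summable)
    show "(\<Sum>n\<le>N. (norm (ell2_nth (X j) n - L n))\<^sup>2) \<le> e\<^sup>2" for N
      using key [OF that, where N = "Suc N"] by (simp only: lessThan_Suc_atMost)
  qed simp
  obtain M1 where M1: "\<And>j k. j \<ge> M1 \<Longrightarrow> k \<ge> M1 \<Longrightarrow> dist (X j) (X k) < 1"
    using metric_CauchyD [OF X, of 1] by auto
  have "summable (\<lambda>n. (norm (ell2_nth (X M1) n + - (ell2_nth (X M1) n - L n)))\<^sup>2)"
    using sum [of M1 M1 1] M1
    by (intro summable_ell2_add summable_ell2_nth) (auto simp: norm_minus_commute)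
  then have "summable (\<lambda>n. (norm (L n))\<^sup>2)" by simp
  then obtain l where l: "ell2_nth l = L"
    using Abs_ell2_inverse [of L] by auto
  have "X \<longlonglongrightarrow> l"
  proof (rule metric_LIMSEQ_I)
    fix r :: real
    assume "0 < r"
    then have "0 < r / 2" by simp
    then obtain M where M: "\<And>j k. j \<ge> M \<Longrightarrow> k \<ge> M \<Longrightarrow> dist (X j) (X k) < r / 2"
      using metric_CauchyD [OF X] by blast
    have "dist (X j) l < r" if "j \<ge> M" for j
    proof -
      have "(norm (X j - l))\<^sup>2 \<le> (r / 2)\<^sup>2"
        unfolding norm_ell2_squared
      proof (rule suminf_le_const [OF summable_ell2_nth])
        show "(\<Sum>n<N. (norm (ell2_nth (X j - l) n))\<^sup>2) \<le> (r / 2)\<^sup>2" for N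
          using key [of M j "r / 2" N] M that by (simp add: minus_ell2.rep_eq l)
      qed
      then have "norm (X j - l) \<le> r / 2"
        by (rule power2_le_imp_le) (use \<open>0 < r\<close> in simp)
      then show ?thesis using \<open>0 < r\<close> by (simp add: dist_norm)
    qed
    then show "\<exists>M. \<forall>j\<ge>M. dist (X j) l < r" by blast
  qed
  then show "convergent X" by (auto simp: convergent_def)
qed

section \<open>Operators\<close>

definition closed_csubspace :: "'a::complex_inner set \<Rightarrow> bool" where
  "closed_csubspace M \<longleftrightarrow> subspace M \<and> closed M \<and> (\<forall>c. \<forall>x\<in>M. c *\<^sub>C x \<in> M)"

text \<open>
  Operators between closed subspaces \<open>M\<close> and \<open>N\<close> are functions on the ambient types of which
  only the values on \<open>M\<close> matter; \<^term>\<open>UNIV\<close> gives operators on the whole space.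
\<close>

definition bounded_clinear_on ::
    "'a::complex_inner set \<Rightarrow> 'b::complex_inner set \<Rightarrow> ('a \<Rightarrow> 'b) \<Rightarrow> bool" where
  "bounded_clinear_on M N A \<longleftrightarrow>
     A ` M \<subseteq> N \<and>
     (\<forall>x\<in>M. \<forall>y\<in>M. A (x + y) = A x + A y) \<and>
     (\<forall>c. \<forall>x\<in>M. A (c *\<^sub>C x) = c *\<^sub>C A x) \<and>
     (\<exists>B. \<forall>x\<in>M. norm (A x) \<le> B * norm x)"

abbreviation bounded_clinear :: "('a::complex_inner \<Rightarrow> 'b::complex_inner) \<Rightarrow> bool" where
  "bounded_clinear \<equiv> bounded_clinear_on UNIV UNIV"

text \<open>
  The adjoint of a bounded operator \<open>A\<close> with domain the closed subspace \<open>M\<close>, as an operator into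
  \<open>M\<close>.  By the Riesz representation theorem the description has exactly one solution.
\<close>

definition cadjoint_on ::
    "'a::complex_inner set \<Rightarrow> ('a \<Rightarrow> 'b::complex_inner) \<Rightarrow> 'b \<Rightarrow> 'a" where
  "cadjoint_on M A y = (THE x. x \<in> M \<and> (\<forall>z\<in>M. cinner (A z) y = cinner z x))"

abbreviation cadjoint :: "('a::complex_inner \<Rightarrow> 'b::complex_inner) \<Rightarrow> 'b \<Rightarrow> 'a" where
  "cadjoint \<equiv> cadjoint_on UNIV"

definition operator_le :: "('a::complex_inner \<Rightarrow> 'a) \<Rightarrow> ('a \<Rightarrow> 'a) \<Rightarrow> bool" where
  "operator_le A B \<longleftrightarrow> (\<forall>x. cinner (B x - A x) x \<in> \<real>\<^sub>\<ge>\<^sub>0)"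

definition expansive :: "('a::complex_inner \<Rightarrow> 'a) \<Rightarrow> bool" where
  "expansive T \<longleftrightarrow> operator_le id (cadjoint T \<circ> T)"

text \<open>Meaningful when \<open>T\<close> is left-invertible, so that \<open>cadjoint T \<circ> T\<close> is a bijection.\<close>

definition cauchy_dual :: "('a::complex_inner \<Rightarrow> 'a) \<Rightarrow> 'a \<Rightarrow> 'a" where
  "cauchy_dual T = T \<circ> inv (cadjoint T \<circ> T)"

definition normal_on :: "'a::complex_inner set \<Rightarrow> ('a \<Rightarrow> 'a) \<Rightarrow> bool" where
  "normal_on M N \<longleftrightarrow> bounded_clinear_on M M N \<and>
     (\<forall>x\<in>M. cadjoint_on M N (N x) = N (cadjoint_on M N x))"

definition quasinormal_on :: "'a::complex_inner set \<Rightarrow> ('a \<Rightarrow> 'a) \<Rightarrow> bool" where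
  "quasinormal_on M Q \<longleftrightarrow> bounded_clinear_on M M Q \<and>
     (\<forall>x\<in>M. Q (cadjoint_on M Q (Q x)) = cadjoint_on M Q (Q (Q x)))"

text \<open>
  The inclusion of the space in a larger one is rendered by an isometric embedding \<open>J\<close>.  As types
  cannot be quantified over, the larger space \<open>K\<close> ranges over the closed subspaces of
  \<^typ>\<open>'a ell2\<close>, which, up to isomorphism, are the Hilbert spaces of dimension at most
  \<open>\<aleph>\<^sub>0 \<cdot> dim H\<close>, where \<open>H\<close> is the space \<^typ>\<open>'a\<close>.  This is no restriction: if \<open>N\<close> on any Hilbert
  space extends \<open>T\<close>, so does its restriction to the smallest closed subspace containing \<open>H\<close>
  that reduces \<open>N\<close>; it is the closed span of the countably many images of \<open>H\<close> under the powers
  of the adjoint of \<open>N\<close> and so obeys that bound.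
\<close>

definition subnormal :: "('a::complex_hilbert \<Rightarrow> 'a) \<Rightarrow> bool" where
  "subnormal T \<longleftrightarrow> bounded_clinear T \<and>
     (\<exists>(K :: 'a ell2 set) J N.
        closed_csubspace K \<and>
        bounded_clinear_on UNIV K J \<and> (\<forall>x y. cinner (J x) (J y) = cinner x y) \<and>
        normal_on K N \<and>
        (\<forall>x. N (J x) = J (T x)))"

definition orthogonal_decomposition :: "'a::complex_inner set \<Rightarrow> 'a set \<Rightarrow> bool" where
  "orthogonal_decomposition H1 H2 \<longleftrightarrow>
     closed_csubspace H1 \<and> closed_csubspace H2 \<and>
     (\<forall>x\<in>H1. \<forall>y\<in>H2. cinner x y = 0) \<and>
     (\<forall>z. \<exists>x\<in>H1. \<exists>y\<in>H2. z = x + y)"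

definition class_Q :: "('a::complex_hilbert \<Rightarrow> 'a) \<Rightarrow> bool" where
  "class_Q T \<longleftrightarrow> bounded_clinear T \<and>
     (\<exists>H1 H2 V E Q.
        orthogonal_decomposition H1 H2 \<and> H1 \<noteq> {0} \<and> H2 \<noteq> {0} \<and>
        bounded_clinear_on H1 H1 V \<and> bounded_clinear_on H2 H1 E \<and> bounded_clinear_on H2 H2 Q \<and>
        (\<forall>x\<in>H1. \<forall>y\<in>H2. T (x + y) = (V x + E y) + Q y) \<and>
        (\<forall>x\<in>H1. cadjoint_on H1 V (V x) = x) \<and>
        (\<forall>y\<in>H2. cadjoint_on H1 V (E y) = 0) \<and>
        (\<forall>y\<in>H2. Q (cadjoint_on H2 E (E y)) = cadjoint_on H2 E (E (Q y))) \<and>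
        quasinormal_on H2 Q)"

end

theory Submission
  imports Defs
begin

text \<open>
  The Cauchy dual of an expansive operator \<open>T\<close> of class Q with blocks \<open>V, E, Q\<close> is the operator
  with blocks \<open>V, E Z, Q Z\<close>, where \<open>Z = (T\<^sup>*T)\<^sup>-\<^sup>1\<close>; since \<open>Q\<close>, \<open>E\<^sup>*E\<close> and \<open>Q\<^sup>*Q\<close> commute with
  \<open>T\<^sup>*T\<close>, it is again of class Q, and it is a contraction.  So it suffices that a contraction
  \<open>T\<close> of class Q is subnormal.  With \<open>p\<close> the projection onto the first summand, the map
  \<open>L x = (p x, E x, E Q x, E Q\<^sup>2 x, \<dots>)\<close> intertwines \<open>T\<close> with the unitary
  \<open>(f\<^sub>0, f\<^sub>1, \<dots>) \<mapsto> (V f\<^sub>0 + f\<^sub>1, f\<^sub>2, \<dots>)\<close> on the square summable sequences with \<open>f\<^sub>0\<close> in the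
  first summand and all other entries in the kernel of \<open>V\<^sup>*\<close>.  Moreover \<open>L\<close> is a contraction and
  \<open>L\<^sup>*L\<close> commutes with \<open>Q\<close>; hence so does the square root \<open>C\<close> of \<open>I - L\<^sup>*L\<close>, which vanishes on
  the first summand.  Therefore \<open>x \<mapsto> (C x, L x)\<close> is an isometry that intertwines \<open>T\<close> with the
  sum of the quasinormal \<open>Q\<close> and that unitary.  Finally \<open>Q\<close> has the normal extension with rows
  \<open>(Q, X)\<close> and \<open>(0, Q\<^sup>*)\<close>, where \<open>X\<close> is the square root of \<open>Q\<^sup>*Q - QQ\<^sup>*\<close>.
\<close>

section \<open>Algebra of the complex inner product\<close>

lemma cinner_add_right: "cinner x (y + z) = cinner x y + cinner x (z::'a::complex_inner)"
  by (metis cinner_add_left cinner_commute complex_cnj_add)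

lemma cinner_scaleC_right: "cinner x (c *\<^sub>C y) = cnj c * cinner x (y::'a::complex_inner)"
  by (metis cinner_commute cinner_scaleC_left complex_cnj_mult)

lemma cinner_zero_left [simp]: "cinner 0 (y::'a::complex_inner) = 0"
  using cinner_add_left [of 0 0 y] by simp

lemma cinner_zero_right [simp]: "cinner (y::'a::complex_inner) 0 = 0"
  using cinner_add_right [of y 0 0] by simp

lemma cinner_minus_left: "cinner (- x) (y::'a::complex_inner) = - cinner x y"
  using cinner_add_left [of x "- x" y] by (simp add: add_eq_0_iff)

lemma cinner_minus_right: "cinner x (- y::'a::complex_inner) = - cinner x y"
  using cinner_add_right [of x y "- y"] by (simp add: add_eq_0_iff)

lemma cinner_diff_left: "cinner (x - y) (z::'a::complex_inner) = cinner x z - cinner y z"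
  by (metis cinner_add_left cinner_minus_left diff_conv_add_uminus)

lemma cinner_diff_right: "cinner x (y - z::'a::complex_inner) = cinner x y - cinner x z"
  by (metis cinner_add_right cinner_minus_right diff_conv_add_uminus)

lemmas cinner_linear = cinner_add_left cinner_add_right cinner_diff_left cinner_diff_right
  cinner_scaleC_left cinner_scaleC_right

lemma cinner_scaleR:
  "cinner (r *\<^sub>R x) (y::'a::complex_inner) = r * cinner x y"
  "cinner x (r *\<^sub>R (y::'a::complex_inner)) = r * cinner x y"
  by (simp_all add: scaleC_of_real [symmetric] cinner_scaleC_left cinner_scaleC_right)

lemma scaleC_zero_right [simp]: "c *\<^sub>C (0::'a::complex_inner) = 0"
  using scaleC_add_right [of c 0 0] by simp

lemma cinner_self: "cinner x x = complex_of_real ((norm (x::'a::complex_inner))\<^sup>2)"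
  using cinner_commute [of x x] Re_cinner [of x x]
  by (auto simp: complex_eq_iff power2_norm_eq_inner)

text \<open>Cauchy-Schwarz bounds the square by \<open>a * norm x\<close>, and one factor
  \<open>norm x\<close> cancels. This yields the norm bounds for adjoints, projections and the Gram
  operator below.\<close>

lemma norm_le_if_cinner_le:
  fixes x :: "'b::real_normed_vector" and y :: "'a::complex_inner"
  assumes "(norm x)\<^sup>2 = Re (cinner y z)" and "norm y \<le> a" "norm z \<le> norm x"
  shows "norm x \<le> a"
proof -
  have "(norm x)\<^sup>2 \<le> norm y * norm z"
    using assms(1) norm_cauchy_schwarz [of y z] by (simp add: Re_cinner)
  also have "\<dots> \<le> a * norm x"
    using assms by (intro mult_mono) (auto intro: order_trans [OF norm_ge_zero])
  finally have "norm x * norm x \<le> a * norm x" by (simp add: power2_eq_square)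
  moreover have "0 \<le> a" using assms(2) norm_ge_zero order_trans by blast
  ultimately show ?thesis
    by (metis mult_le_cancel_right norm_ge_zero order_le_less)
qed

lemma cinner_ext_right:
  fixes x y :: "'a::complex_inner"
  assumes "\<And>z. cinner z x = cinner z y"
  shows "x = y"
proof -
  have "cinner (x - y) (x - y) = 0" using assms [of "x - y"] by (simp add: cinner_diff_right)
  then show ?thesis by (simp add: cinner_self)
qed

lemma cinner_ext_left:
  fixes x y :: "'a::complex_inner"
  assumes "\<And>z. cinner x z = cinner y z"
  shows "x = y"
  by (rule cinner_ext_right) (simp add: cinner_commute [of _ x] cinner_commute [of _ y] assms)

section \<open>Riesz representation\<close>

text \<open>The representing vector minimises \<open>g x = (norm x)\<^sup>2 - 2 * f x\<close> over
  \<open>M\<close>. The parallelogram law makes a minimising sequence Cauchy, and minimality along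
  each line through the limit gives the identity. The real form also serves below to project onto
  the closure of a range.\<close>

lemma riesz_real:
  fixes f :: "'a::{real_inner,complete_space} \<Rightarrow> real"
  assumes sub: "subspace M" and cl: "closed M"
    and add: "\<And>x y. x \<in> M \<Longrightarrow> y \<in> M \<Longrightarrow> f (x + y) = f x + f y"
    and scale: "\<And>c x. x \<in> M \<Longrightarrow> f (c *\<^sub>R x) = c * f x"
    and bnd: "\<And>x. x \<in> M \<Longrightarrow> \<bar>f x\<bar> \<le> B * norm x"
  shows "\<exists>r\<in>M. \<forall>z\<in>M. f z = inner z r"
proof -
  define g where "g x = (norm x)\<^sup>2 - 2 * f x" for x
  define m where "m = Inf (g ` M)"
  have 0: "0 \<in> M" using sub by (rule subspace_0)
  have low: "- B\<^sup>2 \<le> g x" if "x \<in> M" for x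
  proof -
    have "0 \<le> (norm x - B)\<^sup>2" by simp
    then show ?thesis
      using bnd [OF that] by (simp add: g_def power2_eq_square algebra_simps abs_le_iff)
  qed
  have bdd: "bdd_below (g ` M)" using low by (meson bdd_belowI2)
  have m_le: "m \<le> g x" if "x \<in> M" for x
    unfolding m_def using bdd that by (intro cInf_lower) auto
  have "\<exists>x\<in>M. g x < m + 1 / real (Suc n)" for n
    using cInf_lessD [of "g ` M" "m + 1 / real (Suc n)"] 0 by (auto simp: m_def)
  then obtain X where XM: "\<And>n. X n \<in> M" and X: "\<And>n. g (X n) < m + 1 / real (Suc n)"
    by metis
  have half: "f ((1/2) *\<^sub>R (x + y)) = (f x + f y) / 2" if "x \<in> M" "y \<in> M" for x y
    using that sub by (simp add: add scale subspace_add)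
  have close: "(norm (x - y))\<^sup>2 \<le> 2 * (g x - m) + 2 * (g y - m)" if "x \<in> M" "y \<in> M" for x y
  proof -
    have "m \<le> g ((1/2) *\<^sub>R (x + y))"
      using that sub by (intro m_le) (simp add: subspace_add subspace_scale)
    moreover have "(norm (x - y))\<^sup>2 + 4 * g ((1/2) *\<^sub>R (x + y)) = 2 * g x + 2 * g y"
      unfolding g_def half [OF that] power2_norm_eq_inner
      by (simp add: inner_add_left inner_add_right inner_diff_left inner_diff_right
          inner_commute field_simps)
    ultimately show ?thesis by simp
  qed
  have "Cauchy X"
  proof (rule metric_CauchyI)
    fix e :: real
    assume "0 < e"
    obtain N where N: "1 / real (Suc N) < e\<^sup>2 / 4"
      using \<open>0 < e\<close> nat_approx_posE [of "e\<^sup>2 / 4"] by auto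
    have "dist (X i) (X j) < e" if "i \<ge> N" "j \<ge> N" for i j
    proof -
      have "1 / real (Suc i) \<le> 1 / real (Suc N)" "1 / real (Suc j) \<le> 1 / real (Suc N)"
        using that by (auto intro!: divide_left_mono)
      then have "(norm (X i - X j))\<^sup>2 < e\<^sup>2"
        using close [OF XM XM, of i j] X [of i] X [of j] N
        by (simp only: less_divide_eq_numeral1) argo
      then show ?thesis using \<open>0 < e\<close> by (simp add: dist_norm power2_less_imp_less)
    qed
    then show "\<exists>M. \<forall>i\<ge>M. \<forall>j\<ge>M. dist (X i) (X j) < e" by blast
  qed
  then obtain r where r: "X \<longlonglongrightarrow> r"
    by (auto simp: Cauchy_convergent_iff convergent_def)
  have rM: "r \<in> M" using closed_sequentially [OF cl _ r] XM by blast
  have diff: "f (x - y) = f x - f y" if "x \<in> M" "y \<in> M" for x y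
    using add [of x "(-1) *\<^sub>R y"] scale [of y "-1"] that sub
    by (simp add: subspace_neg)
  have fX: "(\<lambda>n. f (X n)) \<longlonglongrightarrow> f r"
  proof (rule LIM_zero_cancel, rule Lim_null_comparison)
    show "\<forall>\<^sub>F n in sequentially. norm (f (X n) - f r) \<le> B * norm (X n - r)"
      using bnd [OF subspace_diff [OF sub XM rM]] by (simp add: diff XM rM)
    show "(\<lambda>n. B * norm (X n - r)) \<longlonglongrightarrow> 0"
      using r by (intro tendsto_mult_right_zero tendsto_norm_zero) (simp add: LIM_zero)
  qed
  have gm: "g r \<le> m"
  proof (rule LIMSEQ_le)
    show "(\<lambda>n. g (X n)) \<longlonglongrightarrow> g r" unfolding g_def by (intro tendsto_intros r fX)
    show "(\<lambda>n. m + 1 / real (Suc n)) \<longlonglongrightarrow> m"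
      using tendsto_add [OF tendsto_const [of m] LIMSEQ_inverse_real_of_nat]
      by (simp add: inverse_eq_divide)
    show "\<exists>N. \<forall>n\<ge>N. g (X n) \<le> m + 1 / real (Suc n)" using X less_imp_le by blast
  qed
  have "f z = inner z r" if z: "z \<in> M" for z
  proof (cases "z = 0")
    case True
    then show ?thesis using scale [OF z, of 0] by simp
  next
    case False
    define d where "d = f z - inner z r"
    \<comment> \<open>Along the line \<open>r + t *\<^sub>R z\<close> the value of \<open>g\<close>
      is a quadratic polynomial in \<open>t\<close>; this is its minimum point.\<close>
    define t where "t = d / (norm z)\<^sup>2"
    have nz: "(norm z)\<^sup>2 > 0" using False by simp
    have tz: "t *\<^sub>R z \<in> M" using sub z by (rule subspace_scale)
    have "g r \<le> g (r + t *\<^sub>R z)"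
      using gm m_le [of "r + t *\<^sub>R z"] subspace_add [OF sub rM tz] by linarith
    moreover have "g (r + t *\<^sub>R z) = g r - 2 * t * d + t\<^sup>2 * (norm z)\<^sup>2"
      unfolding g_def d_def power2_norm_eq_inner
      by (simp add: add rM tz scale z inner_add_left inner_add_right inner_commute
          power2_eq_square algebra_simps)
    moreover have "t\<^sup>2 * (norm z)\<^sup>2 = t * d"
      using nz by (simp add: t_def power2_eq_square)
    ultimately have "t * d \<le> 0" by linarith
    then have "d\<^sup>2 \<le> 0" using nz by (simp add: t_def power2_eq_square divide_le_0_iff)
    then show ?thesis by (simp add: d_def)
  qed
  then show ?thesis using rM by blast
qed

text \<open>The real version represents the real part of \<open>f\<close>; evaluating it at
  \<open>\<i> *\<^sub>C z\<close> recovers the imaginary part.\<close>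

lemma riesz:
  fixes f :: "'a::complex_hilbert \<Rightarrow> complex"
  assumes M: "closed_csubspace M"
    and add: "\<And>x y. x \<in> M \<Longrightarrow> y \<in> M \<Longrightarrow> f (x + y) = f x + f y"
    and scale: "\<And>c x. x \<in> M \<Longrightarrow> f (c *\<^sub>C x) = c * f x"
    and bnd: "\<And>x. x \<in> M \<Longrightarrow> cmod (f x) \<le> B * norm x"
  shows "\<exists>r\<in>M. \<forall>z\<in>M. f z = cinner z r"
proof -
  have sM: "subspace M" "closed M" and cM: "\<And>c x. x \<in> M \<Longrightarrow> c *\<^sub>C x \<in> M"
    using M by (auto simp: closed_csubspace_def)
  have "\<exists>r\<in>M. \<forall>z\<in>M. Re (f z) = inner z r"
  proof (rule riesz_real [OF sM, where B = B])
    show "Re (f (c *\<^sub>R x)) = c * Re (f x)" if "x \<in> M" for c x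
      using scale [OF that, of "complex_of_real c"] by (simp add: scaleC_of_real)
    show "\<bar>Re (f x)\<bar> \<le> B * norm x" if "x \<in> M" for x
      using bnd [OF that] abs_Re_le_cmod order_trans by blast
  qed (simp add: add)
  then obtain r where r: "r \<in> M" and re: "\<And>z. z \<in> M \<Longrightarrow> Re (f z) = inner z r" by blast
  have "f z = cinner z r" if z: "z \<in> M" for z
    using re [OF z] re [OF cM [OF z, of \<i>]] scale [OF z, of \<i>]
    by (auto simp: cinner_via_inner complex_eq_iff)
  then show ?thesis using r by blast
qed

lemma norm_cinner_le: "cmod (cinner x y) \<le> norm x * norm (y::'a::complex_inner)"
proof (cases "cinner x y = 0")
  case False
  \<comment> \<open>This unimodular factor rotates \<open>cinner x y\<close> onto the positive real
    axis, which reduces the claim to the real inequality.\<close>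
  define u where "u = cnj (cinner x y) / cmod (cinner x y)"
  have "u * cinner x y = complex_of_real ((cmod (cinner x y))\<^sup>2) / cmod (cinner x y)"
    unfolding complex_norm_square u_def by simp
  also have "\<dots> = cmod (cinner x y)" by (simp add: power2_eq_square)
  finally have "cmod (cinner x y) = Re (u * cinner x y)" by simp
  also have "\<dots> = Re (cinner (u *\<^sub>C x) y)"
    by (simp add: cinner_scaleC_left)
  also have "\<dots> \<le> norm (u *\<^sub>C x) * norm y"
    unfolding Re_cinner by (rule norm_cauchy_schwarz)
  also have "\<dots> = norm x * norm y"
    using False by (simp add: norm_scaleC u_def norm_divide)
  finally show ?thesis .
qed simp

lemma tendsto_cinner:
  fixes f g :: "'b \<Rightarrow> 'a::complex_inner"
  assumes "(f \<longlongrightarrow> a) F" and "(g \<longlongrightarrow> b) F"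
  shows "((\<lambda>x. cinner (f x) (g x)) \<longlongrightarrow> cinner a b) F"
proof -
  have "bounded_bilinear (cinner :: 'a \<Rightarrow> 'a \<Rightarrow> complex)"
    by (rule bounded_bilinear.intro)
      (auto simp: cinner_linear cinner_scaleR scaleR_conv_of_real intro!: exI [of _ 1] norm_cinner_le)
  then show ?thesis using assms by (rule bounded_bilinear.tendsto)
qed

lemma cadjoint_on_eqI:
  assumes M: "closed_csubspace M" and "x \<in> M" and "\<And>z. z \<in> M \<Longrightarrow> cinner (A z) y = cinner z x"
  shows "cadjoint_on M A y = x"
  unfolding cadjoint_on_def
proof (rule the_equality)
  fix w
  assume w: "w \<in> M \<and> (\<forall>z\<in>M. cinner (A z) y = cinner z w)"
  have "w - x \<in> M" using M w assms(2) by (auto simp: closed_csubspace_def subspace_diff)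
  then have "cinner (w - x) (w - x) = 0"
    using w assms(3) [of "w - x"] by (simp add: cinner_diff_right)
  then show "w = x" by (simp add: cinner_self)
qed (use assms in auto)

text \<open>Cauchy-Schwarz bounds the functional that sends \<open>z\<close> to
  \<open>cinner (A z) y\<close>, so Riesz supplies the vector that the definite description asks
  for.\<close>

lemma cadjoint_on:
  fixes A :: "'a::complex_hilbert \<Rightarrow> 'b::complex_inner"
  assumes M: "closed_csubspace M" and A: "bounded_clinear_on M N A"
  shows "cadjoint_on M A y \<in> M" and "z \<in> M \<Longrightarrow> cinner (A z) y = cinner z (cadjoint_on M A y)"
proof -
  obtain B where B: "\<And>x. x \<in> M \<Longrightarrow> norm (A x) \<le> B * norm x"
    using A unfolding bounded_clinear_on_def by blast
  have "cmod (cinner (A x) y) \<le> (B * norm y) * norm x" if "x \<in> M" for x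
    using norm_cinner_le [of "A x" y] mult_right_mono [OF B [OF that] norm_ge_zero [of y]]
    by (simp add: mult_ac)
  then have "\<exists>r\<in>M. \<forall>z\<in>M. cinner (A z) y = cinner z r"
    using A by (intro riesz [OF M])
      (auto simp: bounded_clinear_on_def cinner_add_left cinner_scaleC_left)
  then obtain r where "r \<in> M" "\<And>z. z \<in> M \<Longrightarrow> cinner (A z) y = cinner z r" by blast
  moreover from this have "cadjoint_on M A y = r" by (intro cadjoint_on_eqI M)
  ultimately show "cadjoint_on M A y \<in> M"
    "z \<in> M \<Longrightarrow> cinner (A z) y = cinner z (cadjoint_on M A y)" by auto
qed

lemma closed_csubspace_UNIV [simp]: "closed_csubspace UNIV"
  by (simp add: closed_csubspace_def)

section \<open>Adjoint pairs\<close>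

text \<open>A relation in place of the description \<open>cadjoint\<close>: an explicit candidate
  for the adjoint is verified directly, and both members of a pair are automatically linear because
  inner products separate vectors.\<close>

definition adjoint_pair :: "('a::complex_inner \<Rightarrow> 'b::complex_inner) \<Rightarrow> ('b \<Rightarrow> 'a) \<Rightarrow> bool" where
  "adjoint_pair A B \<longleftrightarrow> (\<forall>x y. cinner (A x) y = cinner x (B y))"

lemma adjoint_pairD: "adjoint_pair A B \<Longrightarrow> cinner (A x) y = cinner x (B y)"
  by (simp add: adjoint_pair_def)

lemma adjoint_pair_sym:
  assumes "adjoint_pair A B"
  shows "adjoint_pair B A"
  unfolding adjoint_pair_def
proof (intro allI)
  show "cinner (B x) y = cinner x (A y)" for x y
    using adjoint_pairD [OF assms, of y x] cinner_commute [of "B x" y] cinner_commute [of x "A y"]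
    by simp
qed

lemma adjoint_pair_add:
  assumes "adjoint_pair A B"
  shows "A (x + y) = A x + A y"
  by (rule cinner_ext_left) (simp add: adjoint_pairD [OF assms] cinner_linear)

lemma adjoint_pair_diff:
  assumes "adjoint_pair A B"
  shows "A (x - y) = A x - A y"
  by (rule cinner_ext_left) (simp add: adjoint_pairD [OF assms] cinner_linear)

lemma adjoint_pair_scaleC:
  assumes "adjoint_pair A B"
  shows "A (c *\<^sub>C x) = c *\<^sub>C A x"
  by (rule cinner_ext_left) (simp add: adjoint_pairD [OF assms] cinner_linear)

lemma adjoint_pair_scaleR:
  assumes "adjoint_pair A B"
  shows "A (r *\<^sub>R x) = r *\<^sub>R A x"
  by (rule cinner_ext_left) (simp add: adjoint_pairD [OF assms] cinner_scaleR)

lemma adjoint_pair_zero: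
  assumes "adjoint_pair A B"
  shows "A 0 = 0"
  using adjoint_pair_diff [OF assms, of 0 0] by simp

lemma adjoint_pair_cadjoint:
  fixes A :: "'a::complex_hilbert \<Rightarrow> 'b::complex_inner"
  assumes "bounded_clinear A"
  shows "adjoint_pair A (cadjoint A)"
  using cadjoint_on [OF closed_csubspace_UNIV assms] by (simp add: adjoint_pair_def)

lemma cadjoint_eq: "adjoint_pair A B \<Longrightarrow> cadjoint A = B"
  by (rule ext, rule cadjoint_on_eqI) (auto simp: adjoint_pair_def)

lemma adjoint_pair_norm_squared:
  "adjoint_pair A B \<Longrightarrow> (norm (A x))\<^sup>2 = Re (cinner x (B (A x)))"
  by (simp only: adjoint_pairD [of A B x "A x", symmetric] cinner_self Re_complex_of_real)

lemma adjoint_pair_norm_le: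
  assumes "adjoint_pair A B" and "\<And>x. norm (A x) \<le> norm x"
  shows "norm (B x) \<le> norm x"
  by (rule norm_le_if_cinner_le [OF adjoint_pair_norm_squared [OF adjoint_pair_sym [OF assms(1)]]])
    (auto intro: assms(2))

lemma adjoint_pair_bounded_clinear:
  assumes "adjoint_pair A B" and "\<And>x. norm (A x) \<le> c * norm x"
  shows "bounded_clinear A"
  using assms
  by (auto simp: bounded_clinear_on_def adjoint_pair_add [OF assms(1)] adjoint_pair_scaleC [OF assms(1)])

lemma adjoint_pair_comp_adjoint:
  assumes "adjoint_pair A B"
  shows "adjoint_pair (\<lambda>x. B (A x)) (\<lambda>x. B (A x))"
  using assms adjoint_pair_sym [OF assms] by (simp add: adjoint_pair_def)

section \<open>Square roots\<close>

text \<open>For linear \<open>Z\<close>, starting from 0 makes every iterate a real polynomial in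
  \<open>Z\<close>. Hence the iterates inherit self-adjointness and commute with each linear map
  that commutes with \<open>Z\<close>.\<close>

primrec sqrt_iter :: "('a \<Rightarrow> 'a::real_vector) \<Rightarrow> nat \<Rightarrow> 'a \<Rightarrow> 'a" where
  "sqrt_iter Z 0 x = 0"
| "sqrt_iter Z (Suc n) x = (1/2) *\<^sub>R (Z x + sqrt_iter Z n (sqrt_iter Z n x))"

text \<open>The scalar case majorises the operator iteration.\<close>
primrec sqrt_maj :: "nat \<Rightarrow> real" where
  "sqrt_maj 0 = 0"
| "sqrt_maj (Suc n) = (1 + (sqrt_maj n)\<^sup>2) / 2"

lemma sqrt_maj_bounds: "0 \<le> sqrt_maj n \<and> sqrt_maj n \<le> 1 \<and> sqrt_maj n \<le> sqrt_maj (Suc n)"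
proof (induction n)
  case (Suc n)
  then have "sqrt_maj (Suc n) \<le> 1" by (auto simp: power_le_one)
  moreover have "(sqrt_maj n)\<^sup>2 \<le> (sqrt_maj (Suc n))\<^sup>2" using Suc by (intro power_mono) auto
  ultimately show ?case using Suc by (simp del: sqrt_maj.simps(2)) (simp only: sqrt_maj.simps(2), simp)
qed simp

text \<open>If \<open>Y\<close> is the limit of the iteration, then \<open>Y = (Z + Y\<^sup>2) / 2\<close> and hence
  \<open>(I - Y)\<^sup>2 = I - Z\<close>.\<close>
lemma square_root_exists:
  fixes Z :: "'a::complex_hilbert \<Rightarrow> 'a"
  assumes Z: "adjoint_pair Z Z" and contr: "\<And>x. norm (Z x) \<le> norm x"
  obtains C where "adjoint_pair C C" and "\<And>x. C (C x) = x - Z x"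
    and "\<And>A B x. \<lbrakk>adjoint_pair A B; \<And>x. A (Z x) = Z (A x)\<rbrakk> \<Longrightarrow> A (C x) = C (A x)"
proof -
  let ?Y = "sqrt_iter Z" and ?y = sqrt_maj
  have Y: "adjoint_pair (?Y n) (?Y n)" for n
  proof (induction n)
    case (Suc n)
    then show ?case using Z by (simp add: adjoint_pair_def cinner_scaleR cinner_linear)
  qed (simp add: adjoint_pair_def)
  have Y_bound: "norm (?Y n x) \<le> ?y n * norm x" for n x
  proof (induction n arbitrary: x)
    case (Suc n)
    have "norm (?Y n (?Y n x)) \<le> ?y n * (?y n * norm x)"
      using Suc [of "?Y n x"] mult_left_mono [OF Suc [of x], of "?y n"] sqrt_maj_bounds [of n]
      by linarith
    then have "norm (Z x + ?Y n (?Y n x)) \<le> norm x + ?y n * (?y n * norm x)"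
      using norm_triangle_ineq [of "Z x" "?Y n (?Y n x)"] contr [of x] by linarith
    then have "norm (Z x + ?Y n (?Y n x)) \<le> (1 + (?y n)\<^sup>2) * norm x"
      by (simp add: power2_eq_square algebra_simps)
    then show ?case by simp
  qed simp
  \<comment> \<open>For consecutive iterates \<open>Y\<close> and \<open>Y'\<close>,
    \<open>Y' Y' - Y Y = Y' (Y' - Y) + (Y' - Y) Y\<close>. Bounding factor by factor reproduces the
    scalar factorisation of a difference of squares.\<close>
  have Y_step: "norm (?Y (Suc n) x - ?Y n x) \<le> (?y (Suc n) - ?y n) * norm x" for n x
  proof (induction n arbitrary: x)
    case 0
    then show ?case using contr [of x] by simp
  next
    case (Suc n)
    have b: "0 \<le> ?y (Suc n)" using sqrt_maj_bounds [of "Suc n"] by simp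
    have d: "0 \<le> ?y (Suc n) - ?y n" using sqrt_maj_bounds [of n] by simp
    let ?u = "?Y (Suc n) (?Y (Suc n) x - ?Y n x)"
    let ?w = "?Y (Suc n) (?Y n x) - ?Y n (?Y n x)"
    have "?Y (Suc (Suc n)) x - ?Y (Suc n) x
        = (1/2) *\<^sub>R (Z x + ?Y (Suc n) (?Y (Suc n) x)) - (1/2) *\<^sub>R (Z x + ?Y n (?Y n x))"
      by (rule arg_cong2 [where f = minus, OF sqrt_iter.simps(2) sqrt_iter.simps(2)])
    also have "\<dots> = (1/2) *\<^sub>R (?u + ?w)"
      unfolding adjoint_pair_diff [OF Y] by (simp add: algebra_simps del: sqrt_iter.simps)
    finally have eq: "?Y (Suc (Suc n)) x - ?Y (Suc n) x = (1/2) *\<^sub>R (?u + ?w)" .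
    have eq': "?y (Suc (Suc n)) - ?y (Suc n) = (1 + (?y (Suc n))\<^sup>2) / 2 - (1 + (?y n)\<^sup>2) / 2"
      by (rule arg_cong2 [where f = minus, OF sqrt_maj.simps(2) sqrt_maj.simps(2)])
    have "norm ?u \<le> ?y (Suc n) * ((?y (Suc n) - ?y n) * norm x)"
      by (rule order_trans [OF Y_bound mult_left_mono [OF Suc b]])
    moreover have "norm ?w \<le> (?y (Suc n) - ?y n) * (?y n * norm x)"
      by (rule order_trans [OF Suc mult_left_mono [OF Y_bound d]])
    ultimately have "norm (?u + ?w)
        \<le> ?y (Suc n) * ((?y (Suc n) - ?y n) * norm x) + (?y (Suc n) - ?y n) * (?y n * norm x)"
      using norm_triangle_ineq [of ?u ?w] by linarith
    also have "\<dots> = 2 * ((?y (Suc (Suc n)) - ?y (Suc n)) * norm x)"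
      unfolding eq' by (simp add: power2_eq_square algebra_simps del: sqrt_maj.simps)
    finally show ?case unfolding eq by simp
  qed
  have Y_diff: "norm (?Y (n + k) x - ?Y n x) \<le> (?y (n + k) - ?y n) * norm x" for n k x
  proof (induction k)
    case (Suc k)
    then show ?case
      using norm_triangle_ineq [of "?Y (Suc (n + k)) x - ?Y (n + k) x" "?Y (n + k) x - ?Y n x"]
        Y_step [of "n + k" x]
      by (simp add: left_diff_distrib del: sqrt_iter.simps sqrt_maj.simps)
  qed simp
  \<comment> \<open>The majorant increases and stays below 1, so it is Cauchy; \<open>Y_diff\<close>
    transfers this to the iterates at each vector.\<close>
  have "incseq ?y" using sqrt_maj_bounds by (intro incseq_SucI) blast
  then have "convergent ?y"
    using sqrt_maj_bounds by (metis convergent_def incseq_convergent)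
  then have "Cauchy ?y" by (simp add: Cauchy_convergent_iff)
  have "\<exists>l. (\<lambda>n. ?Y n x) \<longlonglongrightarrow> l" for x
  proof -
    have "Cauchy (\<lambda>n. ?Y n x)"
    proof (rule CauchyI')
      fix e :: real
      assume "0 < e"
      then have "0 < e / (norm x + 1)" by (simp add: add_nonneg_pos)
      then obtain M where M: "\<And>m n. M \<le> m \<Longrightarrow> M \<le> n \<Longrightarrow> \<bar>?y m - ?y n\<bar> < e / (norm x + 1)"
        using CauchyD [OF \<open>Cauchy ?y\<close>] by (metis real_norm_def)
      have "norm (?Y m x - ?Y n x) < e" if "M \<le> m" "m < n" for m n
      proof -
        have "norm (?Y m x - ?Y n x) \<le> (?y n - ?y m) * norm x"
          using Y_diff [of m "n - m" x] that by (simp add: norm_minus_commute)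
        also have "\<dots> \<le> (?y n - ?y m) * (norm x + 1)"
          using \<open>incseq ?y\<close> that by (intro mult_left_mono) (auto simp: incseq_def)
        also have "\<dots> < e"
          using M [of n m] that by (subst pos_less_divide_eq [symmetric]) (auto simp: add_nonneg_pos)
        finally show ?thesis .
      qed
      then show "\<exists>M. \<forall>m\<ge>M. \<forall>n>m. dist (?Y m x) (?Y n x) < e"
        by (auto simp: dist_norm)
    qed
    then show ?thesis by (simp add: Cauchy_convergent_iff convergent_def)
  qed
  then obtain L where L: "\<And>x. (\<lambda>n. ?Y n x) \<longlonglongrightarrow> L x" by metis
  have LL: "adjoint_pair L L"
    unfolding adjoint_pair_def
  proof (intro allI)
    fix x y
    have "(\<lambda>n. cinner (?Y n x) y) \<longlonglongrightarrow> cinner (L x) y"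
      "(\<lambda>n. cinner x (?Y n y)) \<longlonglongrightarrow> cinner x (L y)"
      by (intro tendsto_cinner L tendsto_const)+
    then show "cinner (L x) y = cinner x (L y)"
      using LIMSEQ_unique by (simp add: adjoint_pairD [OF Y])
  qed
  have LY: "(\<lambda>n. ?Y n (?Y n x)) \<longlonglongrightarrow> L (L x)" for x
  proof -
    \<comment> \<open>The iterates are contractions, so replacing the inner iterate by its limit
      costs at most \<open>norm (?Y n x - L x)\<close>.\<close>
    have "(\<lambda>n. ?Y n (?Y n x - L x)) \<longlonglongrightarrow> 0"
    proof (rule Lim_null_comparison)
      have "norm (?Y n z) \<le> norm z" for n z
        using Y_bound [of n z] sqrt_maj_bounds [of n] mult_right_mono [of "?y n" 1 "norm z"]
        by simp
      then show "\<forall>\<^sub>F n in sequentially. norm (?Y n (?Y n x - L x)) \<le> norm (?Y n x - L x)" by simp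
      show "(\<lambda>n. norm (?Y n x - L x)) \<longlonglongrightarrow> 0"
        using L by (intro tendsto_norm_zero) (simp add: LIM_zero)
    qed
    then show ?thesis
      using tendsto_add [OF _ L [of "L x"]] by (force simp: adjoint_pair_diff [OF Y])
  qed
  have fixpoint: "L x = (1/2) *\<^sub>R (Z x + L (L x))" for x
  proof (rule LIMSEQ_unique)
    show "(\<lambda>n. ?Y (Suc n) x) \<longlonglongrightarrow> L x" using L by (rule LIMSEQ_Suc)
    show "(\<lambda>n. ?Y (Suc n) x) \<longlonglongrightarrow> (1/2) *\<^sub>R (Z x + L (L x))"
      unfolding sqrt_iter.simps by (intro tendsto_intros LY)
  qed
  show thesis
  proof (rule that [of "\<lambda>x. x - L x"])
    show "adjoint_pair (\<lambda>x. x - L x) (\<lambda>x. x - L x)"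
      using LL by (simp add: adjoint_pair_def cinner_linear)
    have "2 *\<^sub>R L x = Z x + L (L x)" for x by (subst fixpoint) simp
    then show "x - L x - L (x - L x) = x - Z x" for x
      by (simp add: adjoint_pair_diff [OF LL] algebra_simps scaleR_2)
    fix A B x
    assume A: "adjoint_pair A B" and comm: "\<And>x. A (Z x) = Z (A x)"
    have AY: "A (?Y n x) = ?Y n (A x)" for n x
      by (induction n arbitrary: x)
        (simp_all add: adjoint_pair_add [OF A] adjoint_pair_scaleR [OF A] adjoint_pair_zero [OF A] comm)
    \<comment> \<open>Pairing with \<open>w\<close> moves \<open>A\<close> across to
      \<open>B w\<close>, so the limit is taken weakly and the adjoint takes the place of
      continuity.\<close>
    have "A (L x) = L (A x)"
    proof (rule cinner_ext_left)
      fix w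
      have "(\<lambda>n. cinner (?Y n x) (B w)) \<longlonglongrightarrow> cinner (L x) (B w)"
        "(\<lambda>n. cinner (?Y n (A x)) w) \<longlonglongrightarrow> cinner (L (A x)) w"
        by (intro tendsto_cinner L tendsto_const)+
      then show "cinner (A (L x)) w = cinner (L (A x)) w"
        using LIMSEQ_unique by (simp add: adjoint_pairD [OF A, symmetric] AY)
    qed
    then show "A (x - L x) = A x - L (A x)" by (simp add: adjoint_pair_diff [OF A])
  qed
qed

lemma adjoint_pair_inner: "adjoint_pair A B \<Longrightarrow> inner (A x) y = inner x (B y)"
  by (simp only: Re_cinner [symmetric] adjoint_pairD)

lemma subspace_closure:
  fixes S :: "'a::real_normed_vector set"
  assumes "subspace S"
  shows "subspace (closure S)"
proof (rule subspaceI)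
  show "0 \<in> closure S" using subspace_0 [OF assms] closure_subset by blast
  show "x + y \<in> closure S" if xy: "x \<in> closure S" "y \<in> closure S" for x y
  proof -
    obtain u w where "\<forall>n. u n \<in> S" "u \<longlonglongrightarrow> x" "\<forall>n. w n \<in> S" "w \<longlonglongrightarrow> y"
      using xy unfolding closure_sequential by blast
    then show ?thesis
      unfolding closure_sequential
      by (intro exI [of _ "\<lambda>n. u n + w n"]) (auto intro: subspace_add [OF assms] tendsto_add)
  qed
  show "c *\<^sub>R x \<in> closure S" if x: "x \<in> closure S" for c x
  proof -
    obtain u where "\<forall>n. u n \<in> S" "u \<longlonglongrightarrow> x"
      using x unfolding closure_sequential by blast
    then show ?thesis
      unfolding closure_sequential
      by (intro exI [of _ "\<lambda>n. c *\<^sub>R u n"]) (auto intro: subspace_scale [OF assms] tendsto_scaleR)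
  qed
qed

section \<open>Quasinormal contractions\<close>

text \<open>\<open>W = Q\<^sup>*Q - QQ\<^sup>*\<close> satisfies \<open>W\<^sup>2 = Q\<^sup>*Q W\<close>, so it is positive on its range;
  it vanishes on the orthogonal complement of the latter.\<close>
lemma quasinormal_imp_hyponormal:
  fixes q :: "'a::complex_hilbert \<Rightarrow> 'a"
  assumes q: "adjoint_pair q qs" and contr: "\<And>x. norm (q x) \<le> norm x"
    and qn: "\<And>x. q (qs (q x)) = qs (q (q x))"
  shows "norm (qs x) \<le> norm (q x)"
proof -
  define W where "W x = qs (q x) - q (qs x)" for x
  note qs = adjoint_pair_sym [OF q]
  have W: "adjoint_pair W W"
    unfolding adjoint_pair_def W_def
    by (simp add: cinner_linear adjoint_pairD [OF q] adjoint_pairD [OF qs])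
  \<comment> \<open>The adjoint form of \<open>qn\<close>; it shows that \<open>qs\<close>
    annihilates the range of \<open>W\<close>.\<close>
  have qn': "qs (qs (q y)) = qs (q (qs y))" for y
    by (rule cinner_ext_left)
      (simp add: adjoint_pairD [OF q] adjoint_pairD [OF qs] qn)
  have WW: "W (W y) = qs (q (W y))" for y
  proof -
    have "qs (W y) = 0" by (simp add: W_def adjoint_pair_diff [OF qs] qn')
    then show ?thesis by (simp add: W_def [of "W y"] adjoint_pair_zero [OF q])
  qed
  have qs_le: "norm (qs y) \<le> norm y" for y by (rule adjoint_pair_norm_le [OF q contr])
  have W_le: "norm (W y) \<le> 2 * norm y" for y
    using norm_triangle_ineq4 [of "qs (q y)" "q (qs y)"] qs_le [of "q y"] contr [of y]
      contr [of "qs y"] qs_le [of y] unfolding W_def by linarith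
  have W_lin: "bounded_linear W"
    using W_le by (intro bounded_linear_intro [where K = 2])
      (simp_all only: adjoint_pair_add [OF W] adjoint_pair_scaleR [OF W] mult.commute)
  let ?M = "closure (range W)"
  \<comment> \<open>The vector \<open>m\<close> is the orthogonal projection of \<open>x\<close>
    onto the closure of the range of \<open>W\<close>, found by representing
    \<open>inner z x\<close> there.\<close>
  have "\<exists>m\<in>?M. \<forall>z\<in>?M. inner z x = inner z m"
  proof (rule riesz_real)
    show "subspace ?M"
      using linear_subspace_image [OF bounded_linear.linear [OF W_lin] subspace_UNIV] by (rule subspace_closure)
    show "\<bar>inner y x\<bar> \<le> norm x * norm y" for y
      using Cauchy_Schwarz_ineq2 [of y x] by (simp add: mult.commute)
  qed (simp_all add: inner_add_left)
  then obtain m where m: "m \<in> ?M" and orth: "\<forall>z\<in>?M. inner z x = inner z m" by blast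
  \<comment> \<open>Since \<open>x - m\<close> is orthogonal to \<open>W (W (x - m))\<close> and
    \<open>W\<close> is self-adjoint, \<open>W (x - m)\<close> has norm zero; so the quadratic forms
    at \<open>x\<close> and \<open>m\<close> agree.\<close>
  have "W (W (x - m)) \<in> ?M" by (rule subsetD [OF closure_subset]) (rule rangeI)
  with orth have "inner (W (W (x - m))) (x - m) = 0" unfolding inner_diff_right by simp
  then have "W (x - m) = 0" 
    using adjoint_pair_inner [OF W, of "W (x - m)" "x - m"] by simp
  then have Wx: "W x = W m" by (simp add: adjoint_pair_diff [OF W])
  have "inner (W x) x = inner (W m) m" using adjoint_pair_inner [OF W, of m x] Wx
    by (simp add: inner_commute)
  moreover obtain y where y: "(\<lambda>n. W (y n)) \<longlonglongrightarrow> m"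
  proof -
    obtain u where u: "\<forall>n. u n \<in> range W" "u \<longlonglongrightarrow> m" using m closure_sequential by blast
    then have "\<forall>n. \<exists>y. u n = W y" by blast
    then obtain y where "\<And>n. u n = W (y n)" by metis
    then have "u = (\<lambda>n. W (y n))" by blast
    then show thesis using that [of y] u by simp
  qed
  \<comment> \<open>By \<open>WW\<close> the form at \<open>W z\<close> is
    \<open>(norm (q (W z)))\<^sup>2\<close>, and nonnegativity passes to the limit
    \<open>m\<close>.\<close>
  have "0 \<le> inner (W m) m"
  proof (rule LIMSEQ_le_const)
    show "(\<lambda>n. inner (W (W (y n))) (W (y n))) \<longlonglongrightarrow> inner (W m) m"
      by (intro tendsto_inner y bounded_linear.tendsto [OF W_lin])
    have "inner (W (W z)) (W z) = (norm (q (W z)))\<^sup>2" for z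
      unfolding WW adjoint_pair_inner [OF qs] by (rule power2_norm_eq_inner [symmetric])
    then show "\<exists>N. \<forall>n\<ge>N. 0 \<le> inner (W (W (y n))) (W (y n))" by simp
  qed
  ultimately have "0 \<le> inner (W x) x" by simp
  also have "inner (W x) x = (norm (q x))\<^sup>2 - (norm (qs x))\<^sup>2"
    using adjoint_pairD [OF qs, of "q x" x] adjoint_pairD [OF q, of "qs x" x]
    by (simp add: W_def power2_norm_eq_inner cinner_diff_left flip: Re_cinner)
  finally have "(norm (qs x))\<^sup>2 \<le> (norm (q x))\<^sup>2" by simp
  then show ?thesis by (rule power2_le_imp_le) simp
qed

text \<open>By hyponormality \<open>W = Q\<^sup>*Q - QQ\<^sup>*\<close> lies between 0 and the
  identity, so \<open>I - W\<close> is a contraction and \<open>square_root_exists\<close> gives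
  \<open>X\<close> with square \<open>W\<close>. Quasinormality says \<open>W q = 0\<close>; hence
  \<open>X q = 0\<close>, and \<open>qs X = 0\<close> by taking adjoints.\<close>

lemma quasinormal_defect:
  fixes q :: "'a::complex_hilbert \<Rightarrow> 'a"
  assumes q: "adjoint_pair q qs" and contr: "\<And>x. norm (q x) \<le> norm x"
    and qn: "\<And>x. q (qs (q x)) = qs (q (q x))"
  obtains X where "adjoint_pair X X" and "\<And>x. X (X x) = qs (q x) - q (qs x)"
    and "\<And>x. X (q x) = 0" and "\<And>x. qs (X x) = 0"
proof -
  define W where "W x = qs (q x) - q (qs x)" for x
  note qs = adjoint_pair_sym [OF q]
  have W: "adjoint_pair W W"
    unfolding adjoint_pair_def W_def
    by (simp add: cinner_linear adjoint_pairD [OF q] adjoint_pairD [OF qs])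
  have W_inner: "inner (W x) x = (norm (q x))\<^sup>2 - (norm (qs x))\<^sup>2" for x
    using adjoint_pairD [OF qs, of "q x" x] adjoint_pairD [OF q, of "qs x" x]
    by (simp add: W_def power2_norm_eq_inner cinner_diff_left flip: Re_cinner)
  have W_pos: "0 \<le> inner (W x) x" for x
    unfolding W_inner using quasinormal_imp_hyponormal [OF assms, of x] by (simp add: power_mono)
  have W_le: "inner (W x) x \<le> (norm x)\<^sup>2" for x
    unfolding W_inner using contr [of x] by (smt (verit) norm_ge_zero power_mono zero_le_power2)
  \<comment> \<open>Positivity of \<open>W\<close> at \<open>x - W x\<close> and the upper bound at
    \<open>W x\<close> give \<open>(norm (W x))\<^sup>2 \<le> inner (W x) x\<close>; expanding the
    square does the rest.\<close>
  have contr': "norm (x - W x) \<le> norm x" for x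
  proof -
    have "0 \<le> inner (W (x - W x)) (x - W x)" by (rule W_pos)
    also have "\<dots> = inner (W x) x - 2 * (norm (W x))\<^sup>2 + inner (W (W x)) (W x)"
      by (simp add: adjoint_pair_diff [OF W] inner_diff_left inner_diff_right
          adjoint_pair_inner [OF W, of "W x" x]
          power2_norm_eq_inner)
    also have "\<dots> \<le> inner (W x) x - (norm (W x))\<^sup>2" using W_le [of "W x"] by simp
    finally have "(norm (W x))\<^sup>2 \<le> inner (W x) x" by simp
    moreover have "(norm (x - W x))\<^sup>2 = (norm x)\<^sup>2 - 2 * inner (W x) x + (norm (W x))\<^sup>2"
      by (simp add: power2_norm_eq_inner inner_diff_left inner_diff_right inner_commute)
    ultimately have "(norm (x - W x))\<^sup>2 \<le> (norm x)\<^sup>2" using W_pos [of x] by linarith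
    then show ?thesis by (rule power2_le_imp_le) simp
  qed
  have "adjoint_pair (\<lambda>x. x - W x) (\<lambda>x. x - W x)"
    using W by (simp add: adjoint_pair_def cinner_linear)
  then obtain X where X: "adjoint_pair X X" and XX: "\<And>x. X (X x) = x - (x - W x)"
    using contr' by (rule square_root_exists) blast
  have XX': "X (X x) = W x" for x by (simp add: XX)
  have Xq: "X (q x) = 0" for x
  proof -
    have "(norm (X (q x)))\<^sup>2 = 0"
      unfolding adjoint_pair_norm_squared [OF X] XX' by (simp add: W_def qn)
    then show ?thesis by simp
  qed
  have qsX: "qs (X x) = 0" for x
    by (rule cinner_ext_left) (simp add: adjoint_pairD [OF qs] adjoint_pairD [OF X] Xq)
  show thesis by (rule that [OF X _ Xq qsX]) (simp only: XX' W_def)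
qed

section \<open>Sequence spaces\<close>

lemma summable_cinner_ell2: "summable (\<lambda>n. cinner (ell2_nth f n) (ell2_nth g n))"
proof (rule summable_comparison_test')
  show "summable (\<lambda>n. (norm (ell2_nth f n))\<^sup>2 + (norm (ell2_nth g n))\<^sup>2)"
    by (intro summable_add summable_ell2_nth)
  fix n :: nat
  have "cmod (cinner (ell2_nth f n) (ell2_nth g n)) \<le> norm (ell2_nth f n) * norm (ell2_nth g n)"
    by (rule norm_cinner_le)
  also have "\<dots> \<le> (norm (ell2_nth f n))\<^sup>2 + (norm (ell2_nth g n))\<^sup>2"
    using sum_squares_bound [of "norm (ell2_nth f n)" "norm (ell2_nth g n)"]
      mult_nonneg_nonneg [OF norm_ge_zero [of "ell2_nth f n"] norm_ge_zero [of "ell2_nth g n"]]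
    by linarith
  finally show "cmod (cinner (ell2_nth f n) (ell2_nth g n))
      \<le> (norm (ell2_nth f n))\<^sup>2 + (norm (ell2_nth g n))\<^sup>2" .
qed

lemma cinner_ell2_split:
  "cinner f g = (\<Sum>n. cinner (ell2_nth f (n + k)) (ell2_nth g (n + k)))
     + (\<Sum>n<k. cinner (ell2_nth f n) (ell2_nth g n))"
  unfolding cinner_ell2_def by (rule suminf_split_initial_segment [OF summable_cinner_ell2])

lemma norm_ell2_le:
  assumes "\<And>n. norm (ell2_nth f n) \<le> norm (ell2_nth g n)"
  shows "norm f \<le> norm g"
proof (rule power2_le_imp_le)
  show "(norm f)\<^sup>2 \<le> (norm g)\<^sup>2"
    unfolding norm_ell2_squared
    by (rule suminf_le) (simp_all add: assms power_mono summable_ell2_nth)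
qed simp

lemma ell2_eqI: "(\<And>n. ell2_nth f n = ell2_nth g n) \<Longrightarrow> f = g"
  by (simp add: ell2_nth_inject [symmetric] ext)

lemma ell2_nth_Abs: "summable (\<lambda>n. (norm (f n))\<^sup>2) \<Longrightarrow> ell2_nth (Abs_ell2 f) = f"
  by (simp add: Abs_ell2_inverse)

section \<open>Contractions of class Q\<close>

text \<open>The blocks of an operator of class Q, extended by zero to the whole space; \<open>p\<close> is the
  projection onto the first summand.\<close>
locale class_Q_blocks =
  fixes p v vs e es q qs :: "'a::complex_hilbert \<Rightarrow> 'a"
  assumes p_adj: "adjoint_pair p p" and v_adj: "adjoint_pair v vs"
    and e_adj: "adjoint_pair e es" and q_adj: "adjoint_pair q qs"
    and p_p: "p (p x) = p x" and vs_v: "vs (v x) = p x" and p_v: "p (v x) = v x"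
    and v_p: "v (p x) = v x" and p_e: "p (e x) = e x" and e_p: "e (p x) = 0"
    and vs_e: "vs (e x) = 0" and p_q: "p (q x) = 0" and q_p: "q (p x) = 0"
    and q_es_e: "q (es (e x)) = es (e (q x))"
    and q_qs_q: "q (qs (q x)) = qs (q (q x))"
begin

lemmas vs_adj = adjoint_pair_sym [OF v_adj]
  and es_adj = adjoint_pair_sym [OF e_adj]
  and qs_adj = adjoint_pair_sym [OF q_adj]

lemmas adjs = p_adj v_adj vs_adj e_adj es_adj q_adj qs_adj

lemmas adjoint_simps = adjoint_pairD [OF p_adj] adjoint_pairD [OF v_adj] adjoint_pairD [OF e_adj]
  adjoint_pairD [OF q_adj]

lemmas block_zero = adjs [THEN adjoint_pair_zero]
lemmas block_add = adjs [THEN adjoint_pair_add]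
lemmas block_diff = adjs [THEN adjoint_pair_diff]
lemmas block_scaleC = adjs [THEN adjoint_pair_scaleC]

lemma p_qs: "p (qs x) = 0"
  by (rule cinner_ext_right) (simp flip: adjoint_simps add: q_p)

lemma p_vs: "p (vs x) = vs x"
  by (rule cinner_ext_right) (simp flip: adjoint_simps add: v_p)

lemma vs_p: "vs (p x) = vs x"
  by (rule cinner_ext_right) (simp flip: adjoint_simps add: p_v)

definition block_op :: "'a \<Rightarrow> 'a" where
  "block_op x = v x + e x + q x"

text \<open>The ranges of \<open>v\<close>, \<open>e\<close> and \<open>q\<close> are mutually
  orthogonal: \<open>vs_e\<close> separates the first two, while \<open>p\<close> fixes both and
  kills the third. So no cross terms survive.\<close>

lemma cinner_op:
  "cinner (block_op x) (block_op y) = cinner (p x) y + cinner (e x) (e y) + cinner (q x) (q y)"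
proof -
  have ve: "cinner (v x) (e y) = 0" for x y by (simp add: adjoint_pairD [OF v_adj] vs_e)
  have ev: "cinner (e x) (v y) = 0" for x y
    using ve [of y x] cinner_commute [of "e x" "v y"] by simp
  have "cinner (p x) (q y) = 0" for x y by (simp add: adjoint_pairD [OF p_adj] p_q)
  then have vq: "cinner (v x) (q y) = 0" and eq: "cinner (e x) (q y) = 0" for x y
    by (metis p_v, metis p_e)
  have qv: "cinner (q x) (v y) = 0" and qe: "cinner (q x) (e y) = 0" for x y
    using vq [of y x] cinner_commute [of "q x" "v y"] eq [of y x] cinner_commute [of "q x" "e y"]
    by simp_all
  have "cinner (v x) (v y) = cinner (p x) y"
    by (simp add: adjoint_pairD [OF v_adj] adjoint_pairD [OF p_adj] vs_v)
  then show ?thesis by (simp add: block_op_def cinner_linear ve ev vq eq qv qe)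
qed

definition "block_op_adj x = vs x + es x + qs x"

lemma block_op_adjoint: "adjoint_pair block_op block_op_adj"
  unfolding adjoint_pair_def block_op_def block_op_adj_def by (simp add: adjoint_simps cinner_linear)

lemma norm_p_le: "norm (p x) \<le> norm x"
proof (rule norm_le_if_cinner_le)
  show "(norm (p x))\<^sup>2 = Re (cinner x (p x))"
    unfolding adjoint_pair_norm_squared [OF p_adj] p_p ..
qed simp_all

lemma norm_split: "(norm x)\<^sup>2 = (norm (p x))\<^sup>2 + (norm (x - p x))\<^sup>2"
proof -
  have "inner (p x) (x - p x) = 0"
    unfolding adjoint_pair_inner [OF p_adj] by (simp add: block_diff p_p)
  then show ?thesis
    using norm_add_Pythagorean [of "p x" "x - p x"] by (simp add: orthogonal_def)
qed

lemma norm_op_squared: "(norm (block_op x))\<^sup>2 = (norm (p x))\<^sup>2 + (norm (e x))\<^sup>2 + (norm (q x))\<^sup>2"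
proof -
  have "cinner (p x) x = cinner (p x) (p x)"
    by (simp add: adjoint_pairD [OF p_adj] p_p)
  then show ?thesis
    using arg_cong [OF cinner_op [of x x], of Re]
    by (simp only: plus_complex.sel Re_cinner power2_norm_eq_inner)
qed

end

section \<open>The orbit map and its Gram operator\<close>

locale class_Q_contraction = class_Q_blocks +
  assumes contractive: "(norm (e x))\<^sup>2 + (norm (q x))\<^sup>2 \<le> (norm x)\<^sup>2"
begin

lemma norm_q_le: "norm (q x) \<le> norm x"
proof (rule power2_le_imp_le)
  show "(norm (q x))\<^sup>2 \<le> (norm x)\<^sup>2"
    using contractive [of x] zero_le_power2 [of "norm (e x)"] by linarith
qed simp

text \<open>A telescoping sum: \<open>contractive\<close> at \<open>(q ^^ j) x\<close> bounds each
  summand by the drop in squared norm to the next power.\<close>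

lemma e_q_sum: "(\<Sum>j<n. (norm (e ((q ^^ j) x)))\<^sup>2) \<le> (norm x)\<^sup>2 - (norm ((q ^^ n) x))\<^sup>2"
proof (induction n)
  case (Suc n)
  then show ?case using contractive [of "(q ^^ n) x"] by simp
qed simp

lemma e_q_power_p: "e ((q ^^ j) (p x)) = 0"
proof (cases j)
  case (Suc k)
  have "(q ^^ k) 0 = 0" by (induction k) (simp_all add: block_zero)
  then show ?thesis using Suc by (simp add: funpow_Suc_right q_p block_zero del: funpow.simps)
qed (simp add: e_p)

lemma q_power_diff: "(q ^^ j) (x - y) = (q ^^ j) x - (q ^^ j) y"
  by (induction j) (simp_all add: block_diff)

lemma q_power_add: "(q ^^ j) (x + y) = (q ^^ j) x + (q ^^ j) y"
  by (induction j) (simp_all add: block_add)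

lemma q_power_scaleC: "(q ^^ j) (c *\<^sub>C x) = c *\<^sub>C (q ^^ j) x"
  by (induction j) (simp_all add: block_scaleC)

text \<open>The terms vanish on the range of \<open>p\<close>, so \<open>x\<close> may be replaced
  by \<open>x - p x\<close>. This leaves \<open>(norm (p x))\<^sup>2\<close> for the zeroth
  coordinate of \<open>orbit\<close>.\<close>

lemma e_q_sum_le: "(\<Sum>j<n. (norm (e ((q ^^ j) x)))\<^sup>2) \<le> (norm (x - p x))\<^sup>2"
  using e_q_sum [where x = "x - p x" and n = n]
  by (simp add: q_power_diff block_diff e_q_power_p) (smt (verit) zero_le_power2)

lemma e_q_summable: "summable (\<lambda>j. (norm (e ((q ^^ j) x)))\<^sup>2)"
  by (rule bounded_imp_summable [where B = "(norm (x - p x))\<^sup>2"])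
    (simp_all only: zero_le_power2 lessThan_Suc_atMost [symmetric] e_q_sum_le)

text \<open>\<open>orbit\<close> intertwines the operator with a unitary extension of \<open>v\<close>, which shifts the
  coordinates to the left.\<close>
definition orbit_seq :: "'a \<Rightarrow> nat \<Rightarrow> 'a" where
  "orbit_seq x n = (case n of 0 \<Rightarrow> p x | Suc j \<Rightarrow> e ((q ^^ j) x))"

definition orbit :: "'a \<Rightarrow> 'a ell2" where
  "orbit x = Abs_ell2 (orbit_seq x)"

lemma nth_orbit: "ell2_nth (orbit x) = orbit_seq x"
  unfolding orbit_def
proof (rule ell2_nth_Abs)
  show "summable (\<lambda>n. (norm (orbit_seq x n))\<^sup>2)"
    using e_q_summable [of x] by (subst summable_Suc_iff [symmetric]) (simp add: orbit_seq_def)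
qed

lemma orbit_seq_simps [simp]:
  "orbit_seq x 0 = p x" "orbit_seq x (Suc j) = e ((q ^^ j) x)"
  by (simp_all add: orbit_seq_def)

lemma cinner_orbit:
  "cinner (orbit x) (orbit y) = (\<Sum>j. cinner (e ((q ^^ j) x)) (e ((q ^^ j) y))) + cinner (p x) (p y)"
  using cinner_ell2_split [of "orbit x" "orbit y" 1] by (simp add: nth_orbit)

lemma norm_orbit_le: "norm (orbit x) \<le> norm x"
proof (rule power2_le_imp_le)
  have "(norm (orbit x))\<^sup>2 = (\<Sum>j. (norm (e ((q ^^ j) x)))\<^sup>2) + (norm (p x))\<^sup>2"
    using suminf_split_initial_segment [OF summable_ell2_nth [of "orbit x"], of 1]
    by (simp add: norm_ell2_squared nth_orbit)
  moreover have "(\<Sum>j. (norm (e ((q ^^ j) x)))\<^sup>2) \<le> (norm (x - p x))\<^sup>2"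
    by (rule suminf_le_const [OF e_q_summable e_q_sum_le])
  ultimately show "(norm (orbit x))\<^sup>2 \<le> (norm x)\<^sup>2" by (simp add: norm_split [of x])
qed simp

lemma orbit_bounded_clinear: "bounded_clinear orbit"
  unfolding bounded_clinear_on_def
proof (intro conjI ballI allI)
  show "orbit (x + y) = orbit x + orbit y" for x y
    by (rule ell2_eqI)
      (simp add: nth_orbit plus_ell2.rep_eq orbit_seq_def block_add q_power_add split: nat.split)
  show "orbit (c *\<^sub>C x) = c *\<^sub>C orbit x" for c x
    by (rule ell2_eqI)
      (simp add: nth_orbit scaleC_ell2.rep_eq orbit_seq_def block_scaleC q_power_scaleC
        split: nat.split)
  show "\<exists>B. \<forall>x\<in>UNIV. norm (orbit x) \<le> B * norm x"
    by (rule exI [of _ 1]) (simp add: norm_orbit_le)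
qed simp

definition gram :: "'a \<Rightarrow> 'a" where
  "gram x = cadjoint orbit (orbit x)"

lemma cinner_gram: "cinner (gram x) y = cinner (orbit x) (orbit y)"
  unfolding gram_def
  by (rule adjoint_pairD [OF adjoint_pair_sym [OF adjoint_pair_cadjoint [OF orbit_bounded_clinear]]])

lemma gram_adj: "adjoint_pair gram gram"
  unfolding gram_def
  by (rule adjoint_pair_comp_adjoint [OF adjoint_pair_cadjoint [OF orbit_bounded_clinear]])

lemma norm_gram_le: "norm (gram x) \<le> norm x"
proof (rule norm_le_if_cinner_le)
  show "(norm (gram x))\<^sup>2 = Re (cinner (orbit x) (orbit (gram x)))"
    by (simp only: cinner_gram [symmetric] Re_cinner power2_norm_eq_inner)
qed (rule norm_orbit_le)+

text \<open>On the first summand only the zeroth coordinate of \<open>orbit\<close> survives, so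
  \<open>orbit\<close> is isometric there. This is why the root of \<open>I - gram\<close> will
  vanish on it.\<close>

lemma gram_p: "gram (p x) = p x"
proof (rule cinner_ext_left)
  show "cinner (gram (p x)) y = cinner (p x) y" for y
    by (simp add: cinner_gram cinner_orbit e_q_power_p p_p adjoint_pairD [OF p_adj])
qed

text \<open>The operator \<open>qs^j es e q^j\<close>; together with \<open>p\<close> these sum
  weakly to \<open>gram\<close>.\<close>

primrec term_op :: "nat \<Rightarrow> 'a \<Rightarrow> 'a" where
  "term_op 0 x = es (e x)"
| "term_op (Suc j) x = qs (term_op j (q x))"

lemma cinner_term_op: "cinner (e ((q ^^ j) x)) (e ((q ^^ j) y)) = cinner (term_op j x) y"
proof (induction j arbitrary: x y)
  case 0
  then show ?case by (simp add: adjoint_pairD [OF es_adj])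
next
  case (Suc j)
  then show ?case
    by (simp add: funpow_Suc_right adjoint_pairD [OF qs_adj] del: funpow.simps)
qed

text \<open>The induction hypothesis pulls a \<open>q\<close> out of \<open>term_op j (q x)\<close>;
  then \<open>q qs q\<close> appears and quasinormality applies. The base case is the commutation of
  \<open>q\<close> with \<open>es e\<close>.\<close>

lemma q_term_op: "q (term_op j x) = term_op j (q x)"
proof (induction j arbitrary: x)
  case 0
  then show ?case by (simp add: q_es_e)
next
  case (Suc j)
  show ?case by (simp add: q_qs_q flip: Suc)
qed

text \<open>Commutation is checked term by term in the weak sum; the contribution of
  \<open>p\<close> drops out on both sides by \<open>p_qs\<close> and \<open>p_q\<close>.\<close>

lemma q_gram: "q (gram x) = gram (q x)"
proof (rule cinner_ext_left)
  fix y
  have "cinner (q (gram x)) y = (\<Sum>j. cinner (term_op j x) (qs y))"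
    by (simp add: adjoint_pairD [OF q_adj] cinner_gram cinner_orbit p_qs cinner_term_op)
  also have "\<dots> = (\<Sum>j. cinner (term_op j (q x)) y)"
    by (simp add: q_term_op flip: adjoint_pairD [OF q_adj])
  also have "\<dots> = cinner (gram (q x)) y"
    by (simp add: cinner_gram cinner_orbit p_q cinner_term_op)
  finally show "cinner (q (gram x)) y = cinner (gram (q x)) y" .
qed

text \<open>The orthogonal projection onto the kernel of \<open>V\<^sup>*\<close> in the first
  summand, as \<open>v vs\<close> projects onto the range of \<open>V\<close>.\<close>

definition r :: "'a \<Rightarrow> 'a" where
  "r x = p x - v (vs x)"

lemma r_adj: "adjoint_pair r r"
  unfolding adjoint_pair_def r_def
  by (simp add: cinner_linear adjoint_simps adjoint_pairD [OF vs_adj])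

lemmas r_add = adjoint_pair_add [OF r_adj]

lemma v_vs_add_r: "v (vs x) + r x = p x"
  by (simp add: r_def)

lemma r_v: "r (v x) = 0"
  by (simp add: r_def vs_v p_v v_p)

lemma vs_r: "vs (r x) = 0"
  by (simp add: r_def block_diff vs_p vs_v p_vs)

lemma r_r: "r (r x) = r x"
  by (subst r_def) (simp add: vs_r block_zero, simp add: r_def block_diff p_p p_v)

lemma r_e: "r (e x) = e x"
  by (simp add: r_def p_e vs_e block_zero)

lemma norm_r_le: "norm (r x) \<le> norm x"
proof (rule norm_le_if_cinner_le)
  show "(norm (r x))\<^sup>2 = Re (cinner x (r x))"
    unfolding adjoint_pair_norm_squared [OF r_adj] r_r ..
qed simp_all

end

text \<open>Coordinates 0 and 1 carry the normal extension of \<open>q\<close>.  The others carry an extension of \<open>v\<close>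
  that is unitary on a reducing subspace containing the range of \<open>orbit\<close> and zero on its
  complement; this makes the operator normal on the whole sequence space.\<close>
locale class_Q_extension = class_Q_contraction +
  fixes X :: "'a \<Rightarrow> 'a"
  assumes X_adj: "adjoint_pair X X" and X_X: "X (X x) = qs (q x) - q (qs x)"
    and X_q: "X (q x) = 0" and qs_X: "qs (X x) = 0"
begin

lemmas X_add = adjoint_pair_add [OF X_adj]

definition ext_seq :: "(nat \<Rightarrow> 'a) \<Rightarrow> nat \<Rightarrow> 'a" where
  "ext_seq f n = (if n = 0 then q (f 0) + X (f 1) else if n = 1 then qs (f 1)
     else if n = 2 then v (f 2) + r (f 3) else r (f (Suc n)))"

definition ext_adj_seq :: "(nat \<Rightarrow> 'a) \<Rightarrow> nat \<Rightarrow> 'a" where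
  "ext_adj_seq f n = (if n = 0 then qs (f 0) else if n = 1 then X (f 0) + q (f 1)
     else if n = 2 then vs (f 2) else r (f (n - 1)))"

definition normal_ext :: "'a ell2 \<Rightarrow> 'a ell2" where
  "normal_ext f = Abs_ell2 (ext_seq (ell2_nth f))"

definition normal_ext_adj :: "'a ell2 \<Rightarrow> 'a ell2" where
  "normal_ext_adj f = Abs_ell2 (ext_adj_seq (ell2_nth f))"

lemma nth_normal_ext: "ell2_nth (normal_ext f) = ext_seq (ell2_nth f)"
  unfolding normal_ext_def
\<comment> \<open>Only the tail matters for summability: from coordinate 3 on the values are
  \<open>r\<close> applied to the next input coordinate.\<close>
proof (rule ell2_nth_Abs, subst summable_iff_shift [symmetric], rule summable_comparison_test')
  show "summable (\<lambda>n. (norm (ell2_nth f (n + 4)))\<^sup>2)"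
    by (subst summable_iff_shift) (rule summable_ell2_nth)
  show "norm ((norm (ext_seq (ell2_nth f) (n + 3)))\<^sup>2) \<le> (norm (ell2_nth f (n + 4)))\<^sup>2" for n
  proof -
    have "ext_seq (ell2_nth f) (n + 3) = r (ell2_nth f (n + 4))"
      by (simp add: ext_seq_def eval_nat_numeral)
    then show ?thesis by (simp add: power_mono norm_r_le)
  qed
qed

lemma nth_normal_ext_adj: "ell2_nth (normal_ext_adj f) = ext_adj_seq (ell2_nth f)"
  unfolding normal_ext_adj_def
proof (rule ell2_nth_Abs, subst summable_iff_shift [symmetric], rule summable_comparison_test')
  show "summable (\<lambda>n. (norm (ell2_nth f (n + 2)))\<^sup>2)"
    by (subst summable_iff_shift) (rule summable_ell2_nth)
  show "norm ((norm (ext_adj_seq (ell2_nth f) (n + 3)))\<^sup>2) \<le> (norm (ell2_nth f (n + 2)))\<^sup>2" for n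
  proof -
    have "ext_adj_seq (ell2_nth f) (n + 3) = r (ell2_nth f (n + 2))"
      by (simp add: ext_adj_seq_def eval_nat_numeral)
    then show ?thesis by (simp add: power_mono norm_r_le)
  qed
qed

text \<open>Splitting off three coordinates on one side and four on the other aligns the tails,
  since coordinate \<open>n + 4\<close> of \<open>f\<close> meets coordinate \<open>n + 3\<close> of
  \<open>g\<close>.\<close>

lemma normal_ext_adjoint: "adjoint_pair normal_ext normal_ext_adj"
  unfolding adjoint_pair_def
proof (intro allI)
  fix f g
  have "cinner (normal_ext f) g
      = (\<Sum>n. cinner (r (ell2_nth f (n + 4))) (ell2_nth g (n + 3)))
        + (cinner (q (ell2_nth f 0) + X (ell2_nth f 1)) (ell2_nth g 0)
          + cinner (qs (ell2_nth f 1)) (ell2_nth g 1)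
          + cinner (v (ell2_nth f 2) + r (ell2_nth f 3)) (ell2_nth g 2))"
    unfolding cinner_ell2_split [of _ _ 3] nth_normal_ext
    by (simp add: ext_seq_def eval_nat_numeral)
  moreover have "cinner f (normal_ext_adj g)
      = (\<Sum>n. cinner (ell2_nth f (n + 4)) (r (ell2_nth g (n + 3))))
        + (cinner (ell2_nth f 0) (qs (ell2_nth g 0))
          + cinner (ell2_nth f 1) (X (ell2_nth g 0) + q (ell2_nth g 1))
          + cinner (ell2_nth f 2) (vs (ell2_nth g 2)) + cinner (ell2_nth f 3) (r (ell2_nth g 2)))"
    unfolding cinner_ell2_split [of _ _ 4] nth_normal_ext_adj
    by (simp add: ext_adj_seq_def eval_nat_numeral)
  ultimately show "cinner (normal_ext f) g = cinner f (normal_ext_adj g)"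
    by (simp add: adjoint_simps adjoint_pairD [OF qs_adj] adjoint_pairD [OF r_adj]
        adjoint_pairD [OF X_adj] cinner_linear)
qed

text \<open>The common value of \<open>N\<^sup>*N\<close> and \<open>NN\<^sup>*\<close> for
  \<open>N = normal_ext\<close>. In coordinates 0 and 1 the square of \<open>X\<close> makes up for
  \<open>Q\<^sup>*Q - QQ\<^sup>*\<close>; in coordinate 2, \<open>v vs + r = p\<close>.\<close>

definition modulus_seq :: "(nat \<Rightarrow> 'a) \<Rightarrow> nat \<Rightarrow> 'a" where
  "modulus_seq f n = (if n = 0 \<or> n = 1 then qs (q (f n)) else if n = 2 then p (f 2) else r (f n))"

lemma normal_ext_adj_ext: "ell2_nth (normal_ext_adj (normal_ext f)) = modulus_seq (ell2_nth f)"
  unfolding nth_normal_ext nth_normal_ext_adj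
proof (rule ext)
  show "ext_adj_seq (ext_seq (ell2_nth f)) n = modulus_seq (ell2_nth f) n" for n
    by (cases n; cases "n - 1"; cases "n - 2")
      (auto simp: ext_seq_def ext_adj_seq_def modulus_seq_def block_add X_add qs_X X_q
        X_X vs_v vs_r r_v r_r r_add eval_nat_numeral)
qed

lemma normal_ext_ext_adj: "ell2_nth (normal_ext (normal_ext_adj f)) = modulus_seq (ell2_nth f)"
  unfolding nth_normal_ext nth_normal_ext_adj
proof (rule ext)
  show "ext_seq (ext_adj_seq (ell2_nth f)) n = modulus_seq (ell2_nth f) n" for n
    by (cases n; cases "n - 1"; cases "n - 2")
      (auto simp: ext_seq_def ext_adj_seq_def modulus_seq_def block_add X_add qs_X X_q
        X_X r_r r_add eval_nat_numeral v_vs_add_r)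
qed

lemma norm_modulus_seq_le: "norm (modulus_seq f n) \<le> norm (f n)"
proof -
  have "norm (qs (q x)) \<le> norm x" for x
    using adjoint_pair_norm_le [OF q_adj norm_q_le, of "q x"] norm_q_le [of x] by linarith
  then show ?thesis by (simp add: modulus_seq_def norm_p_le norm_r_le)
qed

lemma norm_normal_ext_le: "norm (normal_ext f) \<le> norm f"
proof (rule power2_le_imp_le)
  have "norm (normal_ext_adj (normal_ext f)) \<le> norm f"
    by (rule norm_ell2_le) (simp add: normal_ext_adj_ext norm_modulus_seq_le)
  then have "norm f * norm (normal_ext_adj (normal_ext f)) \<le> (norm f)\<^sup>2"
    by (simp add: power2_eq_square mult_left_mono)
  then show "(norm (normal_ext f))\<^sup>2 \<le> (norm f)\<^sup>2"
    unfolding adjoint_pair_norm_squared [OF normal_ext_adjoint] Re_cinner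
    using norm_cauchy_schwarz [of f "normal_ext_adj (normal_ext f)"] by linarith
qed simp

lemma normal_on_normal_ext: "normal_on UNIV normal_ext"
  unfolding normal_on_def cadjoint_eq [OF normal_ext_adjoint]
  using adjoint_pair_bounded_clinear [OF normal_ext_adjoint, of 1]
  by (auto simp: norm_normal_ext_le normal_ext_ext_adj normal_ext_adj_ext intro!: ell2_eqI)

end

section \<open>The isometric embedding into the sequence space\<close>

context class_Q_contraction
begin

lemma norm_block_op_le: "norm (block_op x) \<le> norm x"
proof (rule power2_le_imp_le)
  have "e x = e (x - p x)" "q x = q (x - p x)" by (simp_all add: block_diff e_p q_p)
  then show "(norm (block_op x))\<^sup>2 \<le> (norm x)\<^sup>2"
    unfolding norm_op_squared norm_split [of x] using contractive [of "x - p x"] by simp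
qed simp

theorem subnormal_block_op: "subnormal block_op"
proof -
  obtain C where C: "adjoint_pair C C" and CC: "\<And>x. C (C x) = x - gram x"
    and C_q: "\<And>x. q (C x) = C (q x)"
    using gram_adj norm_gram_le by (rule square_root_exists) (use q_adj q_gram in blast)
  obtain X where X: "adjoint_pair X X" "\<And>x. X (X x) = qs (q x) - q (qs x)"
    "\<And>x. X (q x) = 0" "\<And>x. qs (X x) = 0"
    using q_adj norm_q_le q_qs_q by (rule quasinormal_defect) blast
  interpret class_Q_extension p v vs e es q qs X
    by unfold_locales (use X in auto)
  have C_p: "C (p x) = 0" for x
    using adjoint_pair_norm_squared [OF C, of "p x"] by (simp add: CC gram_p)
  \<comment> \<open>Coordinate 1, the row added to make \<open>q\<close> normal, starts at zero, so
    only \<open>q\<close> acts on \<open>C x\<close>. The orbit begins at coordinate 2.\<close>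
  define h where "h x n = (if n = 0 then C x else if n = 1 then 0 else orbit_seq x (n - 2))"
    for x and n :: nat
  define J where "J x = Abs_ell2 (h x)" for x
  have h_shift: "h x (n + 2) = ell2_nth (orbit x) n" for x n
    by (simp add: h_def nth_orbit)
  have nth_J: "ell2_nth (J x) = h x" for x
    unfolding J_def
  proof (rule ell2_nth_Abs, subst summable_iff_shift [symmetric])
    show "summable (\<lambda>n. (norm (h x (n + 2)))\<^sup>2)"
      unfolding h_shift by (rule summable_ell2_nth)
  qed
  have cinner_J: "cinner (J x) (J y) = cinner x y" for x y
  proof -
    have "cinner (J x) (J y) = cinner (orbit x) (orbit y) + cinner (C x) (C y)"
      unfolding cinner_ell2_split [of "J x" "J y" 2] nth_J h_shift cinner_ell2_def [of "orbit x"]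
      by (simp add: h_def eval_nat_numeral)
    also have "\<dots> = cinner (gram x) y + cinner (x - gram x) y"
      by (simp add: cinner_gram CC adjoint_pairD [OF C, symmetric])
    finally show ?thesis by (simp add: cinner_diff_left)
  qed
  have J_add: "J (x + y) = J x + J y" for x y
    by (rule ell2_eqI) (auto simp: nth_J plus_ell2.rep_eq h_def adjoint_pair_add [OF C]
        orbit_seq_def block_add q_power_add split: nat.split)
  have J_scaleC: "J (c *\<^sub>C x) = c *\<^sub>C J x" for c x
    by (rule ell2_eqI) (auto simp: nth_J scaleC_ell2.rep_eq h_def adjoint_pair_scaleC [OF C]
        orbit_seq_def block_scaleC q_power_scaleC split: nat.split)
  have norm_J: "norm (J x) = norm x" for x
    using cinner_J [of x x] by (simp add: cinner_self flip: of_real_power)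
  have J: "bounded_clinear J"
    unfolding bounded_clinear_on_def
    by (auto simp: J_add J_scaleC norm_J intro: exI [of _ 1])
  have C_op: "C (block_op x) = C (q x)" for x
    using C_p [of "v x"] C_p [of "e x"]
    by (simp add: block_op_def adjoint_pair_add [OF C] p_v p_e)
  have p_op: "p (block_op x) = v x + e x" for x
    by (simp add: block_op_def block_add p_v p_e p_q)
  have e_op: "e ((q ^^ j) (block_op x)) = e ((q ^^ Suc j) x)" for j x
    using e_q_power_p [of j "v x"] e_q_power_p [of j "e x"]
    by (simp add: block_op_def q_power_add block_add p_v p_e funpow_Suc_right del: funpow.simps)
  \<comment> \<open>In coordinate 0, \<open>C\<close> commutes with \<open>q\<close> and kills the
    other two blocks; in coordinate 2, \<open>r\<close> fixes \<open>e x\<close>, leaving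
    \<open>v x + e x\<close>; later coordinates gain one power of \<open>q\<close>.\<close>
  have "normal_ext (J x) = J (block_op x)" for x
  proof (rule ell2_eqI)
    show "ell2_nth (normal_ext (J x)) n = ell2_nth (J (block_op x)) n" for n
      unfolding nth_normal_ext nth_J
      by (cases n; cases "n - 1"; cases "n - 2")
        (auto simp: ext_seq_def h_def C_q C_op adjoint_pair_zero [OF X_adj] block_zero v_p p_op
          r_e e_op eval_nat_numeral simp del: funpow.simps)
  qed
  moreover have "bounded_clinear block_op"
    by (rule adjoint_pair_bounded_clinear [OF block_op_adjoint, of 1]) (simp add: norm_block_op_le)
  ultimately show ?thesis
    unfolding subnormal_def using J cinner_J normal_on_normal_ext closed_csubspace_UNIV by blast
qed

end

section \<open>The Cauchy dual\<close>

text \<open>The Lax-Milgram argument: coercivity gives injectivity, and a solution of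
  \<open>M y = b\<close> is the Banach fixed point of \<open>y + c *\<^sub>R (b - M y)\<close> for
  small \<open>c\<close>.\<close>

lemma coercive_imp_bij:
  fixes M :: "'a::{real_inner,complete_space} \<Rightarrow> 'a"
  assumes M: "bounded_linear M" and coercive: "\<And>x. (norm x)\<^sup>2 \<le> inner (M x) x"
  shows "bij M"
proof (rule bijI)
  interpret M: bounded_linear M by (rule M)
  show "inj M"
  proof (rule injI)
    show "x = y" if "M x = M y" for x y using coercive [of "x - y"] that by (simp add: M.diff)
  qed
  obtain K0 where K0: "\<And>x. norm (M x) \<le> norm x * K0" using M.bounded by blast
  define K where "K = max K0 1"
  have K: "norm (M x) \<le> K * norm x" for x
  proof -
    have "norm x * K0 \<le> norm x * K" by (simp add: K_def mult_left_mono)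
    then show ?thesis using K0 [of x] by (simp add: mult.commute)
  qed
  have "1 \<le> K" by (simp add: K_def)
  \<comment> \<open>This value minimises the squared contraction factor
    \<open>1 - 2 * c + c\<^sup>2 * K\<^sup>2\<close>, leaving \<open>1 - c\<close>;
    \<open>1 \<le> K\<close> keeps that nonnegative.\<close>
  define c where "c = 1 / K\<^sup>2"
  have c: "0 < c" "c \<le> 1" and cK: "c\<^sup>2 * K\<^sup>2 = c"
    using \<open>1 \<le> K\<close> by (simp_all add: c_def power2_eq_square field_simps mult_ge1_I)
  have step: "norm (d - c *\<^sub>R M d) \<le> sqrt (1 - c) * norm d" for d
  proof (rule power2_le_imp_le)
    have "(norm (M d))\<^sup>2 \<le> K\<^sup>2 * (norm d)\<^sup>2"
      using power_mono [OF K [of d] norm_ge_zero, of 2] by (simp add: power_mult_distrib)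
    then have "c\<^sup>2 * (norm (M d))\<^sup>2 \<le> c\<^sup>2 * (K\<^sup>2 * (norm d)\<^sup>2)"
      by (rule mult_left_mono) simp
    also have "\<dots> = c * (norm d)\<^sup>2" by (simp only: cK flip: mult.assoc)
    finally have "c\<^sup>2 * (norm (M d))\<^sup>2 \<le> c * (norm d)\<^sup>2" .
    moreover have "c * (norm d)\<^sup>2 \<le> c * inner (M d) d"
      using coercive c by (intro mult_left_mono) auto
    moreover have "(norm (d - c *\<^sub>R M d))\<^sup>2
        = (norm d)\<^sup>2 - 2 * (c * inner (M d) d) + c\<^sup>2 * (norm (M d))\<^sup>2"
      unfolding power2_norm_eq_inner
      by (simp add: inner_diff_left inner_diff_right inner_commute power2_eq_square)
    ultimately have "(norm (d - c *\<^sub>R M d))\<^sup>2 \<le> (norm d)\<^sup>2 - c * (norm d)\<^sup>2" by linarith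
    then show "(norm (d - c *\<^sub>R M d))\<^sup>2 \<le> (sqrt (1 - c) * norm d)\<^sup>2"
      using c by (simp add: power_mult_distrib left_diff_distrib)
  qed (use c in simp)
  show "surj M"
  proof (rule surjI)
    fix b
    define g where "g y = y + c *\<^sub>R (b - M y)" for y
    have "dist (g y) (g z) \<le> sqrt (1 - c) * dist y z" for y z
    proof -
      have "g y - g z = (y - z) - c *\<^sub>R M (y - z)"
        by (simp add: g_def M.diff algebra_simps)
      then show ?thesis using step [of "y - z"] by (simp add: dist_norm)
    qed
    then have "\<exists>!y. g y = y"
      using c by (intro banach_fix_type [of "sqrt (1 - c)"]) auto
    then obtain y where "g y = y" by blast
    then have "M y = b" using c by (simp add: g_def)
    then show "M (SOME y. M y = b) = b" by (rule someI)
  qed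
qed

context class_Q_blocks
begin

lemma p_es: "p (es x) = 0"
  by (rule cinner_ext_right) (simp flip: adjoint_simps add: e_p)

lemma es_e_qs: "es (e (qs x)) = qs (es (e x))"
  by (rule cinner_ext_right)
    (simp add: q_es_e adjoint_pairD [OF adjoint_pair_comp_adjoint [OF e_adj], symmetric]
      adjoint_pairD [OF q_adj, symmetric])

lemma adj_op_op: "block_op_adj (block_op x) = p x + es (e x) + qs (q x)"
  by (rule cinner_ext_left)
    (simp only: adjoint_pairD [OF adjoint_pair_sym [OF block_op_adjoint]] cinner_op cinner_add_left
      adjoint_pairD [OF es_adj] adjoint_pairD [OF qs_adj])

end

section \<open>The inverse of the Gramian and the dual blocks\<close>

locale expansive_class_Q_blocks = class_Q_blocks +
  assumes bounded: "\<exists>B. \<forall>x. norm (block_op x) \<le> B * norm x"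
    and expanding: "norm x \<le> norm (block_op x)"
begin

abbreviation "gramian \<equiv> (\<lambda>x. block_op_adj (block_op x))"

lemma gramian_adj: "adjoint_pair gramian gramian"
  by (rule adjoint_pair_comp_adjoint [OF block_op_adjoint])

lemma inner_gramian: "inner (gramian x) x = (norm (block_op x))\<^sup>2"
  by (simp add: adjoint_pair_inner [OF adjoint_pair_sym [OF block_op_adjoint]] power2_norm_eq_inner)

lemma gramian_coercive: "(norm x)\<^sup>2 \<le> inner (gramian x) x"
  unfolding inner_gramian by (rule power_mono [OF expanding norm_ge_zero])

lemma gramian_bij: "bij gramian"
proof (rule coercive_imp_bij [OF _ gramian_coercive])
  obtain B where B: "\<And>x. norm (block_op x) \<le> B * norm x" using bounded by blast
  show "bounded_linear gramian"
  proof (rule bounded_linear_intro [where K = "\<bar>B\<bar> * \<bar>B\<bar>"])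
    fix x
    have B': "norm (block_op y) \<le> \<bar>B\<bar> * norm y" for y
      using B [of y] mult_right_mono [OF abs_ge_self [of B] norm_ge_zero [of y]] by linarith
    have "norm (block_op_adj y) \<le> \<bar>B\<bar> * norm y" for y
    proof -
      have "(norm (block_op_adj y))\<^sup>2 \<le> norm y * norm (block_op (block_op_adj y))"
        using norm_cauchy_schwarz [of y "block_op (block_op_adj y)"]
        unfolding adjoint_pair_norm_squared [OF adjoint_pair_sym [OF block_op_adjoint]] Re_cinner .
      also have "\<dots> \<le> norm y * (\<bar>B\<bar> * norm (block_op_adj y))"
        by (rule mult_left_mono [OF B' norm_ge_zero])
      finally have "norm (block_op_adj y) * norm (block_op_adj y)
          \<le> (\<bar>B\<bar> * norm y) * norm (block_op_adj y)"
        by (simp only: power2_eq_square mult_ac)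
      then show ?thesis
        by (cases "norm (block_op_adj y) = 0") (simp_all add: mult_le_cancel_right)
    qed
    then have "norm (gramian x) \<le> \<bar>B\<bar> * norm (block_op x)" .
    also have "\<dots> \<le> \<bar>B\<bar> * (\<bar>B\<bar> * norm x)" by (rule mult_left_mono [OF B' abs_ge_zero])
    finally show "norm (gramian x) \<le> norm x * (\<bar>B\<bar> * \<bar>B\<bar>)" by (simp only: mult_ac)
  qed (simp_all only: adjoint_pair_add [OF gramian_adj] adjoint_pair_scaleR [OF gramian_adj])
qed

definition z :: "'a \<Rightarrow> 'a" where
  "z = inv gramian"

lemma gramian_z: "gramian (z x) = x"
  unfolding z_def using bij_is_surj [OF gramian_bij] by (rule surj_f_inv_f)

lemma z_gramian: "z (gramian x) = x"
  unfolding z_def using bij_is_inj [OF gramian_bij] by (rule inv_f_f)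

lemma z_adj: "adjoint_pair z z"
  unfolding adjoint_pair_def by (metis adjoint_pairD gramian_adj gramian_z)

lemma z_commute:
  assumes "\<And>x. A (gramian x) = gramian (A x)"
  shows "A (z x) = z (A x)"
  by (metis assms gramian_z z_gramian)

lemma q_z: "q (z x) = z (q x)"
  by (rule z_commute) (simp add: adj_op_op block_add q_p p_q q_es_e q_qs_q)

text \<open>\<open>E\<^sup>*E\<close> commutes with \<open>q\<close> and, by adjoints, with
  \<open>qs\<close>; hence with \<open>gramian\<close> and with its inverse.\<close>

lemma es_e_z: "es (e (z x)) = z (es (e x))"
  by (rule z_commute [of "\<lambda>x. es (e x)"])
    (simp add: adj_op_op block_add e_p block_zero p_es es_e_qs q_es_e)

lemma qs_q_z: "qs (q (z x)) = z (qs (q x))"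
  by (rule z_commute [of "\<lambda>x. qs (q x)"])
    (simp add: adj_op_op block_add q_p block_zero p_qs es_e_qs q_es_e)

lemma p_z: "p (z x) = p x"
proof -
  have "p (gramian (z x)) = p (z x)"
    unfolding adj_op_op by (simp add: block_add p_p p_es p_qs)
  then show ?thesis by (simp add: gramian_z)
qed

lemma z_p: "z (p x) = p x"
proof -
  have "gramian (p x) = p x"
    unfolding adj_op_op by (simp add: p_p e_p q_p block_zero)
  then show ?thesis by (metis z_gramian)
qed

lemma norm_z_le: "norm (z x) \<le> norm x"
proof -
  have "(norm (z x))\<^sup>2 \<le> norm x * norm (z x)"
    using gramian_coercive [of "z x"] norm_cauchy_schwarz [of x "z x"] by (simp add: gramian_z)
  then show ?thesis
    by (cases "norm (z x) = 0") (simp_all add: power2_eq_square mult_le_cancel_right)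
qed

text \<open>The block relations survive because \<open>z\<close> commutes with \<open>q\<close>,
  \<open>es e\<close> and \<open>qs q\<close> and is the identity on the first summand. For
  contractivity, \<open>block_op (z x)\<close> has squared norm \<open>inner x (z x)\<close>, and
  \<open>z\<close> is a contraction.\<close>

lemma dual: "class_Q_contraction p v vs (\<lambda>x. e (z x)) (\<lambda>x. z (es x)) (\<lambda>x. q (z x)) (\<lambda>x. z (qs x))"
proof unfold_locales
  show "adjoint_pair (\<lambda>x. e (z x)) (\<lambda>x. z (es x))" "adjoint_pair (\<lambda>x. q (z x)) (\<lambda>x. z (qs x))"
    unfolding adjoint_pair_def
    by (simp_all add: adjoint_pairD [OF e_adj] adjoint_pairD [OF q_adj] adjoint_pairD [OF z_adj])
  fix x
  show "q (z (z (es (e (z x))))) = z (es (e (z (q (z x)))))"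
    by (simp add: es_e_z q_z q_es_e)
  show "q (z (z (qs (q (z x))))) = z (qs (q (z (q (z x)))))"
    unfolding qs_q_z q_qs_q [symmetric] by (simp only: q_z)
  have "(norm (e (z x)))\<^sup>2 + (norm (q (z x)))\<^sup>2 \<le> (norm (block_op (z x)))\<^sup>2"
    by (simp add: norm_op_squared)
  also have "\<dots> = inner x (z x)" using inner_gramian [of "z x"] by (simp add: gramian_z)
  also have "\<dots> \<le> norm x * norm (z x)" by (rule norm_cauchy_schwarz)
  also have "\<dots> \<le> (norm x)\<^sup>2" by (simp add: power2_eq_square mult_left_mono norm_z_le)
  finally show "(norm (e (z x)))\<^sup>2 + (norm (q (z x)))\<^sup>2 \<le> (norm x)\<^sup>2" .
qed (simp_all add: p_adj v_adj p_p vs_v p_v v_p p_e z_p e_p vs_e p_q q_p)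

theorem cauchy_dual_block_op:
  "subnormal (cauchy_dual block_op)" "onorm (cauchy_dual block_op) \<le> 1"
proof -
  interpret dual: class_Q_contraction p v vs "\<lambda>x. e (z x)" "\<lambda>x. z (es x)" "\<lambda>x. q (z x)"
    "\<lambda>x. z (qs x)"
    by (rule dual)
  have "v (z x) = v x" for x by (metis p_z v_p)
  then have "block_op (z x) = dual.block_op x" for x
    by (simp add: block_op_def dual.block_op_def)
  moreover have "cauchy_dual block_op = (\<lambda>x. block_op (z x))"
    unfolding cauchy_dual_def cadjoint_eq [OF block_op_adjoint] z_def comp_def ..
  ultimately have eq: "cauchy_dual block_op = dual.block_op" by auto
  show "subnormal (cauchy_dual block_op)" unfolding eq by (rule dual.subnormal_block_op)
  show "onorm (cauchy_dual block_op) \<le> 1"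
    unfolding eq by (rule onorm_bound) (simp_all add: dual.norm_block_op_le)
qed

end

text \<open>Composing \<open>V\<close> with the projection \<open>p\<close> and \<open>E\<close>,
  \<open>Q\<close> with its complement extends the blocks by zero. Their adjoints on the subspaces
  are already functions on the whole space with values in \<open>H1\<close> or \<open>H2\<close>,
  and so are the adjoints of the extensions.\<close>

lemma class_Q_imp_blocks:
  fixes T :: "'a::complex_hilbert \<Rightarrow> 'a"
  assumes "class_Q T"
  obtains p v vs e es q qs
  where "class_Q_blocks p v vs e es q qs" and "\<And>x. T x = v x + e x + q x"
proof -
  obtain H1 H2 V E Q where D: "orthogonal_decomposition H1 H2"
    and V: "bounded_clinear_on H1 H1 V" and E: "bounded_clinear_on H2 H1 E"
    and Q: "bounded_clinear_on H2 H2 Q"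
    and T: "\<And>x y. x \<in> H1 \<Longrightarrow> y \<in> H2 \<Longrightarrow> T (x + y) = (V x + E y) + Q y"
    and VV: "\<And>x. x \<in> H1 \<Longrightarrow> cadjoint_on H1 V (V x) = x"
    and VE: "\<And>y. y \<in> H2 \<Longrightarrow> cadjoint_on H1 V (E y) = 0"
    and QEE: "\<And>y. y \<in> H2 \<Longrightarrow> Q (cadjoint_on H2 E (E y)) = cadjoint_on H2 E (E (Q y))"
    and QQQ: "\<And>y. y \<in> H2 \<Longrightarrow> Q (cadjoint_on H2 Q (Q y)) = cadjoint_on H2 Q (Q (Q y))"
    using assms unfolding class_Q_def quasinormal_on_def by blast
  have H1: "closed_csubspace H1" and H2: "closed_csubspace H2"
    and orth: "\<And>x y. x \<in> H1 \<Longrightarrow> y \<in> H2 \<Longrightarrow> cinner x y = 0"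
    and span: "\<And>z. \<exists>x\<in>H1. \<exists>y\<in>H2. z = x + y"
    using D unfolding orthogonal_decomposition_def by blast+
  have orth': "cinner y x = 0" if "x \<in> H1" "y \<in> H2" for x y
    using orth [OF that] cinner_commute [of y x] by simp
  have "\<exists>x\<in>H1. z - x \<in> H2" for z
    using span [of z] by (metis add_diff_cancel_left')
  \<comment> \<open>A pointwise choice of first components; orthogonality then makes
    \<open>p\<close> self-adjoint, and hence linear.\<close>
  then obtain p where p1: "\<And>z. p z \<in> H1" and p2: "\<And>z. z - p z \<in> H2" by metis
  have p_eq: "cinner x y = cinner (p x) y" if "y \<in> H1" for x y
    using orth' [OF that p2 [of x]] by (simp add: cinner_diff_left)
  have p_eq': "cinner (x - p x) y = cinner x y" if "y \<in> H2" for x y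
    using orth [OF p1 [of x] that] by (simp add: cinner_diff_left)
  have p_adj: "adjoint_pair p p"
    unfolding adjoint_pair_def
  proof (intro allI)
    show "cinner (p x) y = cinner x (p y)" for x y
      using orth [OF p1 [of x] p2 [of y]] p_eq [OF p1 [of y], of x] by (simp add: cinner_diff_right)
  qed
  have sub: "subspace H1" "subspace H2" using H1 H2 by (auto simp: closed_csubspace_def)
  have p_H1: "p x = x" if "x \<in> H1" for x
  proof -
    have "x - p x \<in> H1" using that p1 sub by (intro subspace_diff)
    then have "cinner (x - p x) (x - p x) = 0" using orth p2 by blast
    then show ?thesis by (simp add: cinner_self)
  qed
  have p_H2: "p y = 0" if "y \<in> H2" for y
  proof -
    have "y - (y - p y) \<in> H2" by (rule subspace_diff [OF sub(2) that p2])
    then have "cinner (p y) (p y) = 0" using orth p1 by simp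
    then show ?thesis by (simp add: cinner_self)
  qed
  have V_H1: "V x \<in> H1" if "x \<in> H1" for x using V that by (auto simp: bounded_clinear_on_def)
  have E_H1: "E x \<in> H1" if "x \<in> H2" for x using E that by (auto simp: bounded_clinear_on_def)
  have Q_H2: "Q x \<in> H2" if "x \<in> H2" for x using Q that by (auto simp: bounded_clinear_on_def)
  define e where "e x = E (x - p x)" for x
  define q where "q x = Q (x - p x)" for x
  have v_adj: "adjoint_pair (\<lambda>x. V (p x)) (cadjoint_on H1 V)"
    unfolding adjoint_pair_def
    by (simp add: cadjoint_on [OF H1 V] p1 p_eq [symmetric])
  have e_adj: "adjoint_pair e (cadjoint_on H2 E)"
    unfolding adjoint_pair_def e_def
    by (simp add: cadjoint_on [OF H2 E] p2 p_eq')
  have q_adj: "adjoint_pair q (cadjoint_on H2 Q)"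
    unfolding adjoint_pair_def q_def
    by (simp add: cadjoint_on [OF H2 Q] p2 p_eq')
  have e0: "E 0 = 0" using adjoint_pair_zero [OF e_adj] adjoint_pair_zero [OF p_adj] by (simp add: e_def)
  have q0: "Q 0 = 0" using adjoint_pair_zero [OF q_adj] adjoint_pair_zero [OF p_adj] by (simp add: q_def)
  have p_p: "p (p x) = p x" for x by (rule p_H1 [OF p1])
  show thesis
  proof (rule that)
    show "class_Q_blocks p (\<lambda>x. V (p x)) (cadjoint_on H1 V) e (cadjoint_on H2 E) q (cadjoint_on H2 Q)"
      by unfold_locales
        (simp_all add: p_adj v_adj e_adj q_adj p_p VV VE p1 p2 p_H1 V_H1 E_H1 Q_H2 p_H2 e_def q_def
          e0 q0 QEE QQQ cadjoint_on(1) [OF H2 E] cadjoint_on(1) [OF H2 Q])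
    show "T x = V (p x) + e x + q x" for x
      using T [OF p1 p2, of x x] by (simp add: e_def q_def)
  qed
qed

theorem corollary6p2:
  fixes T :: "'a::complex_hilbert \<Rightarrow> 'a"
  assumes "class_Q T"
    and "expansive T"
  shows "subnormal (cauchy_dual T) \<and> onorm (cauchy_dual T) \<le> 1"
proof -
  obtain p v vs e es q qs where "class_Q_blocks p v vs e es q qs"
    and T: "\<And>x. T x = v x + e x + q x"
    using class_Q_imp_blocks [OF assms(1)] by blast
  then interpret class_Q_blocks p v vs e es q qs by simp
  have T_eq: "T = block_op" using T by (auto simp: block_op_def)
  have T_bounded: "bounded_clinear T" using assms(1) by (simp add: class_Q_def)
  \<comment> \<open>The real part of the quadratic form of \<open>T\<^sup>*T - I\<close> is
    \<open>(norm (T x))\<^sup>2 - (norm x)\<^sup>2\<close>.\<close>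
  have "norm x \<le> norm (T x)" for x
  proof (rule power2_le_imp_le)
    have "cinner ((cadjoint T \<circ> T) x - id x) x \<in> \<real>\<^sub>\<ge>\<^sub>0"
      using assms(2) by (simp only: expansive_def operator_le_def)
    then have "0 \<le> inner (cadjoint T (T x) - x) x"
      by (simp add: complex_nonneg_Reals_iff Re_cinner)
    then show "(norm x)\<^sup>2 \<le> (norm (T x))\<^sup>2"
      by (simp add: inner_diff_left power2_norm_eq_inner
          adjoint_pair_inner [OF adjoint_pair_sym [OF adjoint_pair_cadjoint [OF T_bounded]]])
  qed simp
  then interpret expansive_class_Q_blocks p v vs e es q qs
    using T_bounded by unfold_locales (auto simp: T_eq bounded_clinear_on_def)
  show ?thesis unfolding T_eq using cauchy_dual_block_op by blast
qed

end
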